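(* Let $(\omega_{n})_{n=1}^{\infty}$ be a sequence of real numbers with $\omega_n\to\infty$ which is growing regularly, i.e. for each $m\in\mathbb{N}$ there exists $K_m\in\mathbb{N}$ such that $\omega_{n+m}/\omega_n\ge 1/K_m$ for every $n\in\mathbb{N}$. Then for Lebesgue almost every $\beta\in(1.497\ldots,2)$, the set of $x\in I_{\beta}=[0,\frac{1}{\beta-1}]$ that have a $\beta$-expansion $(\epsilon_{i})_{i=1}^{\infty}$ satisfying $$0\leq x-\sum_{i=1}^{n}\frac{\epsilon_{i}}{\beta^{i}}\leq \frac{\omega_{n}}{2^{n}}$$ for infinitely many $n\in\mathbb{N}$ is of full Lebesgue measure within $I_{\beta}$.
   Context: For $\beta\in(1,2)$ and $x\in I_\beta$, a sequence $(\epsilon_i)_{i=1}^\infty\in\{0,1\}^{\mathbb{N}}$ is a $\beta$-expansion of $x$ if $x=\sum_{i=1}^\infty\epsilon_i\beta^{-i}$. The number $1.497\ldots$ is a specific constant (the lower endpoint of the interval of $\beta$ on which the transversality-based counting estimates of Benjamini and Solomyak hold). *)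

theory Defs
  imports "HOL-Analysis.Analysis"
begin

definition I_beta :: "real \<Rightarrow> real set" where
  "I_beta \<beta> = {0 .. 1 / (\<beta> - 1)}"

text \<open>Sequences are indexed from 1 as in the paper; the entry at index 0 plays no role.\<close>

definition beta_expansion :: "real \<Rightarrow> real \<Rightarrow> (nat \<Rightarrow> nat) \<Rightarrow> bool" where
  "beta_expansion \<beta> x \<epsilon> \<longleftrightarrow>
     (\<forall>i\<ge>1. \<epsilon> i \<in> {0, 1}) \<and> (\<lambda>i. real (\<epsilon> (Suc i)) / \<beta> ^ Suc i) sums x"

text \<open>The bound \<open>K \<ge> 1\<close> excludes \<open>1 / K = 0\<close> for \<open>K = 0\<close>. If some \<open>\<omega> n\<close> with \<open>n \<ge> 1\<close> is
  \<open>0\<close>, the quotient is \<open>0\<close> and the condition fails. Together with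
  \<open>\<omega> \<longlonglongrightarrow> \<infinity>\<close> the condition therefore forces \<open>\<omega> n > 0\<close> for all \<open>n \<ge> 1\<close>.\<close>

definition growing_regularly :: "(nat \<Rightarrow> real) \<Rightarrow> bool" where
  "growing_regularly \<omega> \<longleftrightarrow>
     (\<forall>m\<ge>1. \<exists>K::nat. K \<ge> 1 \<and> (\<forall>n\<ge>1. \<omega> (n + m) / \<omega> n \<ge> 1 / real K))"

definition well_approximable :: "real \<Rightarrow> (nat \<Rightarrow> real) \<Rightarrow> real set" where
  "well_approximable \<beta> \<omega> =
     {x \<in> I_beta \<beta>. \<exists>\<epsilon>. beta_expansion \<beta> x \<epsilon> \<and>
        (\<exists>\<^sub>\<infinity>n. 0 \<le> x - (\<Sum>i=1..n. real (\<epsilon> i) / \<beta> ^ i) \<and>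
              x - (\<Sum>i=1..n. real (\<epsilon> i) / \<beta> ^ i) \<le> \<omega> n / 2 ^ n)}"

text \<open>The constant \<open>1.497...\<close>: Benjamini and Solomyak work with the contraction ratio
  \<open>1 / \<beta>\<close> in the transversality interval \<open>(1/2, 0.668)\<close>, so \<open>\<beta>\<close> ranges over
  \<open>(1 / 0.668, 2)\<close>, where \<open>1 / 0.668 = 1.497005...\<close>.\<close>

definition beta_transversality :: real where
  "beta_transversality = 1 / 0.668"

end

theory Submission
  imports Defs
begin

text \<open>
  Put \<open>q = 1 / \<beta>\<close>. Two words of length \<open>n\<close> that first differ at position \<open>k\<close> have partial sums
  at distance \<open>q ^ k * \<bar>g q\<bar>\<close>, where \<open>g\<close> is a power series with coefficients in \<open>{-1, 0, 1}\<close> and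
  \<open>g 0 = 1\<close>. Such series are transversal on \<open>[1/2, 0.668]\<close>: the set where \<open>\<bar>g\<bar> \<le> \<rho>\<close> has
  measure \<open>O(\<rho>)\<close>, uniformly in \<open>g\<close>. Hence the expected number of pairs of words at distance at most
  \<open>c / 2 ^ n\<close> is \<open>O(c * 2 ^ n)\<close>, and for almost every \<open>q\<close> some \<open>c > 0\<close> admits infinitely many
  \<open>n\<close> for which half of the \<open>2 ^ n\<close> partial sums are \<open>c / 2 ^ n\<close>-separated. So the points that lie
  infinitely often within \<open>O(1 / 2 ^ n)\<close> to the right of a partial sum have positive measure. As that set
  is mapped into itself by the two contractions of the iterated function system, it has positive lower
  density everywhere, so its complement is null by the Vitali covering theorem.
  Finally, since \<open>\<omega>\<close> tends to infinity, an expansion is obtained by concatenating good words,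
  as long as no remainder falls into the null set, which excludes only countably many affine copies of it.
\<close>

section \<open>Transversality\<close>

text \<open>With t = y / x > 1, the factor t ^ i is at most t ^ N where the coefficients are
  nonnegative and at least t ^ N where they are nonpositive. So termwise the series at y is at most
  t ^ N times the series at x, and a negative value \<open>u\<close> can only move down. The
  coefficient at \<open>N\<close> may have either sign.\<close>

lemma single_sign_change_decreasing:
  fixes d :: "nat \<Rightarrow> real"
  assumes x: "(\<lambda>i. d i * x ^ i) sums u" and y: "(\<lambda>i. d i * y ^ i) sums v"
    and "0 < x" "x < y"
    and pos: "\<And>i. i < N \<Longrightarrow> 0 \<le> d i" and neg: "\<And>i. N < i \<Longrightarrow> d i \<le> 0"
    and "u < 0"
  shows "v \<le> u"
proof -
  have le: "d i * y ^ i \<le> (y / x) ^ N * (d i * x ^ i)" for i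
  proof -
    have eq: "d i * y ^ i = (y / x) ^ i * (d i * x ^ i)"
      using \<open>0 < x\<close> by (simp add: power_divide)
    have one: "1 \<le> y / x" using assms by simp
    consider "i < N" | "i = N" | "N < i" by linarith
    then show ?thesis
    proof cases
      case 1
      then show ?thesis unfolding eq using one pos[of i] \<open>0 < x\<close>
        by (intro mult_right_mono power_increasing) auto
    next
      case 3
      have "(y / x) ^ N \<le> (y / x) ^ i" using one 3 by (intro power_increasing) auto
      then show ?thesis unfolding eq using neg[of i] 3 \<open>0 < x\<close>
        by (intro mult_right_mono_neg) (auto intro: mult_nonpos_nonneg)
    next
      case 2
      then show ?thesis using eq by (metis order_refl)
    qed
  qed
  have "v \<le> (y / x) ^ N * u"
    by (rule sums_le[OF le y sums_mult[OF x]])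
  also have "\<dots> \<le> 1 * u"
    using assms by (intro mult_right_mono_neg one_le_power) auto
  finally show ?thesis by simp
qed

text \<open>
  \<open>g - h\<close> has a single sign change in its coefficients, so wherever \<open>g\<close> is smaller than \<open>h\<close> it
  decreases at least as fast as \<open>h\<close>.
\<close>

lemma star_function_separates:
  fixes b c :: "nat \<Rightarrow> real"
  assumes g: "\<And>x. x \<in> {l..r} \<Longrightarrow> (\<lambda>i. b i * x ^ i) sums g x"
    and h: "\<And>x. x \<in> {l..r} \<Longrightarrow> (\<lambda>i. c i * x ^ i) sums h x"
    and ge: "\<And>i. i < N \<Longrightarrow> c i \<le> b i" and le: "\<And>i. N < i \<Longrightarrow> b i \<le> c i"
    and pos: "\<And>x. x \<in> {l..r} \<Longrightarrow> \<delta> \<le> h x"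
    and steep: "\<And>x y. x \<in> {l..r} \<Longrightarrow> y \<in> {l..r} \<Longrightarrow> x < y \<Longrightarrow> \<delta> * (y - x) \<le> h x - h y"
    and "0 < l" "r \<le> 1" "0 < \<delta>"
    and xy: "x \<in> {l..r}" "y \<in> {l..r}" "x < y"
    and small: "\<bar>g x\<bar> \<le> \<rho>" "\<bar>g y\<bar> \<le> \<rho>"
  shows "y - x \<le> 2 * \<rho> / \<delta>"
proof (cases "\<rho> < \<delta>")
  case True
  have d: "(\<lambda>i. (b i - c i) * z ^ i) sums (g z - h z)" if "z \<in> {l..r}" for z
    using sums_diff[OF g[OF that] h[OF that]] by (simp add: left_diff_distrib)
  \<comment> \<open>For \<rho> < \<delta> the function \<open>g\<close> lies below \<open>h\<close>
    at x, so \<open>g\<close> inherits the decrease of \<open>h\<close> from x to y. As |g| is at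
    most \<rho> at both points, that decrease is at most 2 * \<rho>.\<close>
  have "g x - h x < 0" using small pos[OF xy(1)] True by linarith
  then have "g y - h y \<le> g x - h x"
    using single_sign_change_decreasing[OF d[OF xy(1)] d[OF xy(2)], of N] ge le xy \<open>0 < l\<close> by auto
  then have "\<delta> * (y - x) \<le> 2 * \<rho>" using steep[OF xy] small by linarith
  then show ?thesis using \<open>0 < \<delta>\<close> by (simp add: field_simps)
next
  case False
  \<comment> \<open>For \<rho> >= \<delta> the claimed bound is at least 2, more than any distance
    in the interval.\<close>
  have "y - x \<le> 2" using xy assms by auto
  also have "2 \<le> 2 * \<rho> / \<delta>" using False \<open>0 < \<delta>\<close> by (simp add: field_simps)
  finally show ?thesis .
qed

section \<open>Series with coefficients -1, 0, 1 and their sets of small values\<close>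

definition series :: "(nat \<Rightarrow> int) \<Rightarrow> real \<Rightarrow> real" where
  "series b x = (\<Sum>i. real_of_int (b i) * x ^ i)"

definition has_prefix :: "int list \<Rightarrow> (nat \<Rightarrow> int) \<Rightarrow> bool" where
  "has_prefix p b \<longleftrightarrow> range b \<subseteq> {-1, 0, 1} \<and> (\<forall>i<length p. b i = p ! i)"

definition covered :: "nat \<Rightarrow> real \<Rightarrow> real set \<Rightarrow> bool" where
  "covered k d S \<longleftrightarrow> (\<exists>T. finite T \<and> card T \<le> k \<and> S \<subseteq> (\<Union>t\<in>T. cball t d))"

text \<open>The number of balls is uniform in the series and in \<rho>. The factor 20000 is 2 /
  \<delta> for \<delta> = 1/10000 in \<open>star_function_separates\<close>. Counting balls instead
  of measuring makes the property additive over pieces of the interval.\<close>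

definition transversal :: "int list \<Rightarrow> real \<Rightarrow> real \<Rightarrow> bool" where
  "transversal p l r \<longleftrightarrow> (\<exists>k. \<forall>b \<rho>. has_prefix p b \<longrightarrow>
     covered k (20000 * \<rho>) {x \<in> {l..r}. \<bar>series b x\<bar> \<le> \<rho>})"

lemma series_sums:
  assumes "range b \<subseteq> {-1, 0, 1}" "0 \<le> x" "x < 1"
  shows "(\<lambda>i. real_of_int (b i) * x ^ i) sums series b x"
proof -
  have "norm (real_of_int (b i) * x ^ i) \<le> x ^ i" for i
  proof -
    have "b i \<in> {-1, 0, 1}" using assms(1) by blast
    then show ?thesis using assms by auto
  qed
  then have "summable (\<lambda>i. real_of_int (b i) * x ^ i)"
    using assms by (intro summable_comparison_test'[OF summable_geometric[of x], of 0]) auto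
  then show ?thesis by (simp add: series_def summable_sums)
qed

text \<open>One ball around any point of \<open>S\<close> suffices; the last hypothesis makes its
  radius nonnegative, so that it contains its centre.\<close>

lemma coveredI:
  assumes "1 \<le> k" "\<And>x y. x \<in> S \<Longrightarrow> y \<in> S \<Longrightarrow> x < y \<Longrightarrow> y - x \<le> d" "\<And>x. x \<in> S \<Longrightarrow> 0 \<le> d"
  shows "covered k d S"
proof (cases "S = {}")
  case True
  then show ?thesis by (auto simp: covered_def intro: exI[of _ "{}"])
next
  case False
  then obtain t where t: "t \<in> S" by auto
  have "dist t x \<le> d" if "x \<in> S" for x
    using assms(2)[OF that t] assms(2)[OF t that] assms(3)[OF t]
    by (cases x t rule: linorder_cases) (auto simp: dist_real_def)
  then show ?thesis unfolding covered_def using assms(1) by (intro exI[of _ "{t}"]) auto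
qed

lemma covered_Un:
  assumes "covered j d S" "covered k d S'"
  shows "covered (j + k) d (S \<union> S')"
proof -
  obtain T T' where "finite T" "card T \<le> j" "S \<subseteq> (\<Union>t\<in>T. cball t d)"
    "finite T'" "card T' \<le> k" "S' \<subseteq> (\<Union>t\<in>T'. cball t d)"
    using assms by (auto simp: covered_def)
  then show ?thesis unfolding covered_def
    by (intro exI[of _ "T \<union> T'"]) (use card_Un_le[of T T'] in auto)
qed

lemma covered_mono: "covered j d S \<Longrightarrow> j \<le> k \<Longrightarrow> S' \<subseteq> S \<Longrightarrow> covered k d S'"
  unfolding covered_def by (meson order_trans)

text \<open>
  Certificates of transversality for the series with a given prefix of coefficients. A series is bounded
  below (\<open>Positive\<close>), or it is compared with a star function of Solomyak (\<open>Decreasing k a\<close>): the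
  prefix, then \<open>k\<close> coefficients \<open>-1\<close>, the coefficient \<open>a/4\<close>, and only \<open>1\<close> from there on.
  Branching on the next coefficient is indispensable: for coefficients ranging over the real interval
  \<open>[-1, 1]\<close>, double zeros already occur near \<open>0.6491\<close>.
\<close>

datatype cert = Positive | Decreasing nat int | Flip cert | Cut int cert cert | Branch cert cert cert

text \<open>
  Fixed-point lower bounds: endpoints are in units of \<open>1/10000\<close>, values in units of \<open>1/1000000\<close>, and
  \<open>div\<close> rounds down. Coefficients are multiplied by 4, so that \<open>a/4\<close> becomes an integer, and the
  threshold \<open>400\<close> in \<open>check\<close> stands for \<open>\<delta> = 1/10000\<close>.
\<close>

fun horner_lower :: "int \<Rightarrow> int \<Rightarrow> int \<Rightarrow> int list \<Rightarrow> int" where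
  "horner_lower l r t [] = t"
| "horner_lower l r t (c # cs) =
     (let v = horner_lower l r t cs in c * 1000000 + (v * (if 0 \<le> v then l else r)) div 10000)"

text \<open>The signs are flipped because an upper bound on the derivative is needed.\<close>

fun deriv_coeffs :: "int \<Rightarrow> int list \<Rightarrow> int list" where
  "deriv_coeffs i [] = []"
| "deriv_coeffs i (c # cs) = (- i * c) # deriv_coeffs (i + 1) cs"

text \<open>The last numeric argument of \<open>horner_lower\<close> is the scaled tail: all later
  coefficients -1 (\<open>Positive\<close>) or 1 (\<open>Decreasing\<close>) give a geometric
  series, evaluated at the right endpoint, where its size is largest. The value of the star function
  is checked only at \<open>r\<close>, because the second condition makes it decreasing. The tail in
  that condition comes from differentiating 4 * x ^ n / (1 - x) with n =
  \<open>length cs\<close>.\<close>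

fun check :: "int list \<Rightarrow> int \<Rightarrow> int \<Rightarrow> cert \<Rightarrow> bool" where
  "check p l r Positive \<longleftrightarrow>
     400 \<le> horner_lower l r ((- 40000000000) div (10000 - r)) (map ((*) 4) p)"
| "check p l r (Decreasing k a) \<longleftrightarrow>
     (let cs = map ((*) 4) p @ replicate k (- 4) @ [a] in
       400 \<le> horner_lower r r (40000000000 div (10000 - r)) cs \<and>
       400 \<le> horner_lower l r
         ((- 40000000000 * (int (length cs) * (10000 - r) + r)) div (10000 - r) ^ 2)
         (deriv_coeffs 1 (tl cs)))"
| "check p l r (Flip c) \<longleftrightarrow> check (map uminus p) l r c"
| "check p l r (Cut m c d) \<longleftrightarrow> l \<le> m \<and> m \<le> r \<and> check p l m c \<and> check p m r d"
| "check p l r (Branch c d e) \<longleftrightarrow>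
     check (p @ [- 1]) l r c \<and> check (p @ [0]) l r d \<and> check (p @ [1]) l r e"

section \<open>Soundness of the certificate checks\<close>

lemma has_prefix_snoc:
  assumes "has_prefix p b"
  shows "has_prefix (p @ [b (length p)]) b"
  using assms by (auto simp: has_prefix_def nth_append less_Suc_eq)

lemma transversal_Flip:
  assumes "transversal (map uminus p) l r" "0 \<le> l" "r < 1"
  shows "transversal p l r"
proof -
  obtain k where k: "\<And>b \<rho>. has_prefix (map uminus p) b \<Longrightarrow>
     covered k (20000 * \<rho>) {x \<in> {l..r}. \<bar>series b x\<bar> \<le> \<rho>}"
    using assms by (auto simp: transversal_def)
  have "covered k (20000 * \<rho>) {x \<in> {l..r}. \<bar>series b x\<bar> \<le> \<rho>}" if b: "has_prefix p b" for b \<rho>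
  proof -
    have "series (\<lambda>i. - b i) x = - series b x" if "x \<in> {l..r}" for x
      using sums_minus[OF series_sums[of b x]] b that assms(2,3)
      by (auto simp: series_def has_prefix_def sums_iff)
    then have "{x \<in> {l..r}. \<bar>series b x\<bar> \<le> \<rho>} = {x \<in> {l..r}. \<bar>series (\<lambda>i. - b i) x\<bar> \<le> \<rho>}"
      by auto
    moreover have "has_prefix (map uminus p) (\<lambda>i. - b i)"
      using b by (auto simp: has_prefix_def)
    ultimately show ?thesis using k by metis
  qed
  then show ?thesis unfolding transversal_def by (intro exI allI impI)
qed

lemma transversal_Cut:
  assumes "transversal p l m" "transversal p m r"
  shows "transversal p l r"
proof -
  obtain j k where
    jk: "\<And>b \<rho>. has_prefix p b \<Longrightarrow> covered j (20000 * \<rho>) {x \<in> {l..m}. \<bar>series b x\<bar> \<le> \<rho>}"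
      "\<And>b \<rho>. has_prefix p b \<Longrightarrow> covered k (20000 * \<rho>) {x \<in> {m..r}. \<bar>series b x\<bar> \<le> \<rho>}"
    using assms unfolding transversal_def by blast
  have "covered (j + k) (20000 * \<rho>) {x \<in> {l..r}. \<bar>series b x\<bar> \<le> \<rho>}" if "has_prefix p b" for b \<rho>
    by (rule covered_mono[OF covered_Un[OF jk(1)[OF that, of \<rho>] jk(2)[OF that, of \<rho>]]]) auto
  then show ?thesis unfolding transversal_def by (intro exI allI impI)
qed

lemma transversal_Branch:
  assumes "transversal (p @ [-1]) l r" "transversal (p @ [0]) l r" "transversal (p @ [1]) l r"
  shows "transversal p l r"
proof -
  obtain i j k where
    ijk: "\<And>b \<rho>. has_prefix (p @ [-1]) b \<Longrightarrow> covered i (20000 * \<rho>) {x \<in> {l..r}. \<bar>series b x\<bar> \<le> \<rho>}"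
      "\<And>b \<rho>. has_prefix (p @ [0]) b \<Longrightarrow> covered j (20000 * \<rho>) {x \<in> {l..r}. \<bar>series b x\<bar> \<le> \<rho>}"
      "\<And>b \<rho>. has_prefix (p @ [1]) b \<Longrightarrow> covered k (20000 * \<rho>) {x \<in> {l..r}. \<bar>series b x\<bar> \<le> \<rho>}"
    using assms unfolding transversal_def by blast
  have "covered (i + j + k) (20000 * \<rho>) {x \<in> {l..r}. \<bar>series b x\<bar> \<le> \<rho>}"
    if b: "has_prefix p b" for b \<rho>
  proof -
    have "b (length p) \<in> {-1, 0, 1}" using b by (auto simp: has_prefix_def)
    then have "has_prefix (p @ [-1]) b \<or> has_prefix (p @ [0]) b \<or> has_prefix (p @ [1]) b"
      using has_prefix_snoc[OF b] by auto
    then show ?thesis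
    proof (elim disjE)
      assume "has_prefix (p @ [-1]) b"
      from ijk(1)[OF this] show ?thesis by (rule covered_mono) auto
    next
      assume "has_prefix (p @ [0]) b"
      from ijk(2)[OF this] show ?thesis by (rule covered_mono) auto
    next
      assume "has_prefix (p @ [1]) b"
      from ijk(3)[OF this] show ?thesis by (rule covered_mono) auto
    qed
  qed
  then show ?thesis unfolding transversal_def by (intro exI allI impI)
qed

text \<open>Each Horner step multiplies the value v of the rest by x; the smallest product over the
  interval uses the left endpoint if v >= 0 and the right one otherwise, and \<open>div\<close>
  rounds down. The real \<tau> is the scaled tail at the point \<open>x\<close>, with the integer
  \<open>t\<close> as a lower bound.\<close>

lemma horner_lower:
  fixes x :: real
  assumes "0 \<le> l" "of_int l \<le> 10000 * x" "10000 * x \<le> of_int r" "of_int t \<le> \<tau>"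
  shows "of_int (horner_lower l r t cs) \<le> 1000000 * horner_sum of_int x cs + x ^ length cs * \<tau>"
proof (induction cs)
  case Nil
  then show ?case using assms by simp
next
  case (Cons c cs)
  define v where "v = horner_lower l r t cs"
  have x: "0 \<le> x" using assms(1,2) by linarith
  have "real_of_int (v * (if 0 \<le> v then l else r) div 10000) \<le>
      real_of_int (v * (if 0 \<le> v then l else r)) / 10000"
    using real_of_int_div4[of "v * (if 0 \<le> v then l else r)" 10000] by simp
  also have "\<dots> \<le> of_int v * x"
  proof (cases "0 \<le> v")
    case True
    then show ?thesis using mult_left_mono[OF assms(2), of "of_int v"] by simp
  next
    case False
    then show ?thesis using mult_left_mono_neg[OF assms(3), of "of_int v"] by simp
  qed
  also have "\<dots> \<le> (1000000 * horner_sum of_int x cs + x ^ length cs * \<tau>) * x"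
    using Cons x by (intro mult_right_mono) (auto simp: v_def)
  finally show ?case by (simp add: Let_def v_def[symmetric] algebra_simps)
qed

lemma prefix_series_sums:
  fixes x :: real
  assumes "0 \<le> x" "x < 1"
  shows "(\<lambda>i. (if i < length cs then of_int (cs ! i) else s) * x ^ i) sums
    (horner_sum of_int x cs + s * x ^ length cs / (1 - x))"
proof -
  have "(\<lambda>i. s * x ^ length cs * x ^ i) sums (s * x ^ length cs * (1 / (1 - x)))"
    using assms by (intro sums_mult geometric_sums) auto
  then have "(\<lambda>i. (if i + length cs < length cs then of_int (cs ! (i + length cs)) else s) * x ^ (i + length cs))
      sums (s * x ^ length cs / (1 - x))"
    by (simp add: power_add mult_ac)
  then show ?thesis
    by (subst (asm) sums_iff_shift) (simp add: horner_sum_eq_sum add.commute atLeast0LessThan)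
qed

text \<open>As the series is at least 1/10000, either the set is empty, or \<rho> >= 1/10000 and a
  ball of radius 20000 * \<rho> >= 2 around any of its points contains the whole interval.\<close>

lemma transversal_Positive:
  assumes "0 \<le> l" "r < 10000" "check p l r Positive"
  shows "transversal p (of_int l / 10000) (of_int r / 10000)"
proof -
  have "1 / 10000 \<le> series b x"
    if b: "has_prefix p b" and x: "x \<in> {of_int l / 10000..of_int r / 10000}" for b x
  proof -
    let ?t = "- 40000000000 div (10000 - r)"
    have x01: "0 \<le> x" "x < 1" using x assms by auto
    have "real_of_int ?t \<le> - 40000000000 / (10000 - r)"
      using real_of_int_div4[of "- 40000000000" "10000 - r"] by simp
    also have "\<dots> \<le> - 4000000 / (1 - x)"
      using x x01 assms by (simp add: field_simps)
    finally have t: "real_of_int ?t \<le> - 4000000 / (1 - x)" .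
    define A where "A = x ^ length p / (1 - x)"
    have A: "x ^ length p * (- 4000000 / (1 - x)) = - 4000000 * A"
      "(- 4) * x ^ length p / (1 - x) = - 4 * A" by (simp_all add: A_def)
    have "400 \<le> 1000000 * horner_sum of_int x (map ((*) 4) p) - 4000000 * A"
      using horner_lower[OF \<open>0 \<le> l\<close> _ _ t, where x = x and r = r and cs = "map ((*) 4) p"] x assms(3)
      unfolding length_map A(1) by auto
    then have "1 / 10000 \<le> (horner_sum of_int x (map ((*) 4) p) + (- 4) * x ^ length p / (1 - x)) / 4"
      unfolding A(2) by simp
    \<comment> \<open>Termwise comparison with the smallest series that has this prefix, the one
      that continues with -1 throughout.\<close>
    also have "\<dots> \<le> series b x"
    proof (rule sums_le)
      show "(\<lambda>i. of_int (b i) * x ^ i) sums series b x"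
        using b x01 by (intro series_sums) (auto simp: has_prefix_def)
      show "(\<lambda>i. (if i < length (map ((*) 4) p) then of_int (map ((*) 4) p ! i) else - 4) * x ^ i / 4) sums
          ((horner_sum of_int x (map ((*) 4) p) + (- 4) * x ^ length p / (1 - x)) / 4)"
        using sums_divide[OF prefix_series_sums[OF x01, of "map ((*) 4) p" "-4"], of 4] by simp
      show "(if i < length (map ((*) 4) p) then of_int (map ((*) 4) p ! i) else - 4) * x ^ i / 4
          \<le> of_int (b i) * x ^ i" for i
      proof -
        have "b i \<in> {-1, 0, 1}" using b by (auto simp: has_prefix_def)
        then show ?thesis using b x01 by (auto simp: has_prefix_def)
      qed
    qed
    finally show ?thesis .
  qed
  then have "covered 1 (20000 * \<rho>) {x \<in> {of_int l / 10000..of_int r / 10000}. \<bar>series b x\<bar> \<le> \<rho>}"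
    if "has_prefix p b" for b \<rho>
    using that assms by (intro coveredI) fastforce+
  then show ?thesis unfolding transversal_def by (intro exI allI impI)
qed

text \<open>Taking off the first coefficient turns x ^ (j + 1) into x ^ (j + 2), so the induction
  needs an arbitrary offset \<open>j\<close>, matched by the starting index of
  \<open>deriv_coeffs\<close>.\<close>

lemma DERIV_horner_sum_Suc:
  fixes x :: real
  shows "((\<lambda>x. x ^ Suc j * horner_sum of_int x cs) has_real_derivative
     - (x ^ j * horner_sum of_int x (deriv_coeffs (int (Suc j)) cs))) (at x)"
proof (induction cs arbitrary: j)
  case Nil
  then show ?case by simp
next
  case (Cons c cs)
  have "((\<lambda>x. of_int c * x ^ Suc j + x ^ Suc (Suc j) * horner_sum of_int x cs) has_real_derivative
      of_int c * (real (Suc j) * x ^ j)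
        + - (x ^ Suc j * horner_sum of_int x (deriv_coeffs (int (Suc (Suc j))) cs))) (at x)"
    by (intro DERIV_add[OF _ Cons] DERIV_cmult) (use DERIV_pow[of "Suc j" x UNIV] in simp)
  moreover have "int (Suc (Suc j)) = int (Suc j) + 1" by simp
  ultimately show ?case
    by (simp add: algebra_simps)
qed

lemma DERIV_horner_sum:
  fixes x :: real
  shows "((\<lambda>x. horner_sum of_int x cs) has_real_derivative
     - horner_sum of_int x (deriv_coeffs 1 (tl cs))) (at x)"
proof (cases cs)
  case (Cons c cs')
  show ?thesis
    using DERIV_add[OF DERIV_const[of "of_int c"] DERIV_horner_sum_Suc[of 0 cs' x]]
    by (simp add: Cons)
qed simp

lemma length_deriv_coeffs [simp]: "length (deriv_coeffs i cs) = length cs"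
  by (induction cs arbitrary: i) auto

text \<open>Four times the star function is \<open>h\<close>. The checks give h' <= -4/10000 on the
  interval and h >= 4/10000 at its right end, hence both conditions on h / 4 in
  \<open>star_function_separates\<close> with \<delta> = 1/10000. Before position N =
  \<open>length p + k\<close> the coefficients of h / 4 are at most those of any series with prefix
  \<open>p\<close>, after it at least as large; \<open>a\<close> sits at N itself, where no
  comparison is required.\<close>

lemma transversal_Decreasing:
  assumes "0 < l" "r < 10000" "check p l r (Decreasing k a)"
  shows "transversal p (of_int l / 10000) (of_int r / 10000)"
proof -
  define cs where "cs = map ((*) 4) p @ replicate k (- 4) @ [a]"
  define N where "N = length p + k"
  have len: "length cs = Suc N" by (simp add: cs_def N_def)
  define h where "h x = horner_sum of_int x cs + 4 * x ^ Suc N / (1 - x)" for x :: real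
  define h' where "h' x = - horner_sum of_int x (deriv_coeffs 1 (tl cs))
    + 4 * x ^ N * ((Suc N * (1 - x) + x) / (1 - x)\<^sup>2)" for x :: real
  let ?l = "real_of_int l / 10000" and ?r = "real_of_int r / 10000"
  have checks: "400 \<le> horner_lower r r (40000000000 div (10000 - r)) cs"
    "400 \<le> horner_lower l r
         ((- 40000000000 * (int (Suc N) * (10000 - r) + r)) div (10000 - r)\<^sup>2)
         (deriv_coeffs 1 (tl cs))"
    using assms(3) by (simp_all add: cs_def[symmetric] Let_def len)
  have h: "(h has_real_derivative h' x) (at x)" if "x < 1" for x
  proof -
    have "((\<lambda>x. 4 * x ^ Suc N / (1 - x)) has_real_derivative
        4 * x ^ N * ((Suc N * (1 - x) + x) / (1 - x)\<^sup>2)) (at x)"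
    proof (rule DERIV_cong)
      show "((\<lambda>x. 4 * x ^ Suc N / (1 - x)) has_real_derivative
        (4 * (Suc N * x ^ N) * (1 - x) - 4 * x ^ Suc N * (0 - 1)) / ((1 - x) * (1 - x))) (at x)"
        using that DERIV_pow[of "Suc N" x UNIV]
        by (intro DERIV_divide DERIV_cmult DERIV_diff DERIV_const DERIV_ident) auto
      show "(4 * (Suc N * x ^ N) * (1 - x) - 4 * x ^ Suc N * (0 - 1)) / ((1 - x) * (1 - x)) =
        4 * x ^ N * ((Suc N * (1 - x) + x) / (1 - x)\<^sup>2)"
        by (simp add: power2_eq_square algebra_simps)
    qed
    then show ?thesis
      unfolding h_def h'_def by (rule DERIV_add[OF DERIV_horner_sum])
  qed
  have h'_le: "h' x \<le> - 4 / 10000" if x: "x \<in> {?l..?r}" for x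
  proof -
    have x01: "0 \<le> x" "x < 1" using x assms(1,2) by auto
    let ?m = "int (Suc N) * (10000 - r) + r"
    let ?t = "- 40000000000 * ?m div (10000 - r)\<^sup>2"
    let ?\<tau> = "- 4000000 * ((Suc N * (1 - x) + x) / (1 - x)\<^sup>2)"
    \<comment> \<open>Split into two summands that increase with x, the factor is bounded by its
      value at the right endpoint.\<close>
    have "(Suc N * (1 - x) + x) / (1 - x)\<^sup>2 = Suc N / (1 - x) + x / (1 - x)\<^sup>2"
      using x01 by (simp add: add_divide_distrib power2_eq_square)
    also have "\<dots> \<le> Suc N / (1 - ?r) + ?r / (1 - ?r)\<^sup>2"
      using x x01 assms by (intro add_mono frac_le power_mono) auto
    also have "\<dots> = 10000 * ?m / (10000 - r)\<^sup>2"
      using assms by (simp add: divide_simps) (simp add: power2_eq_square algebra_simps)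
    finally have "- 4000000 * (10000 * ?m / (10000 - r)\<^sup>2) \<le> ?\<tau>"
      by (intro mult_left_mono_neg) auto
    then have "- 40000000000 * ?m / (10000 - r)\<^sup>2 \<le> ?\<tau>"
      by simp
    moreover have "real_of_int ?t \<le> - 40000000000 * ?m / (10000 - r)\<^sup>2"
      using real_of_int_div4[of "- 40000000000 * ?m" "(10000 - r)\<^sup>2"] by simp
    ultimately have t: "real_of_int ?t \<le> ?\<tau>" by linarith
    define A where "A = x ^ N * ((Suc N * (1 - x) + x) / (1 - x)\<^sup>2)"
    have A: "x ^ N * ?\<tau> = - 4000000 * A"
      "4 * x ^ N * ((Suc N * (1 - x) + x) / (1 - x)\<^sup>2) = 4 * A"
      unfolding A_def by (rule mult.left_commute, rule mult.assoc)
    have "400 \<le> real_of_int (horner_lower l r ?t (deriv_coeffs 1 (tl cs)))"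
      using checks(2) by linarith
    also have "\<dots> \<le> 1000000 * horner_sum of_int x (deriv_coeffs 1 (tl cs))
        + x ^ length (deriv_coeffs 1 (tl cs)) * ?\<tau>"
      by (rule horner_lower[OF _ _ _ t]) (use x assms(1) in auto)
    finally have "400 \<le> 1000000 * horner_sum of_int x (deriv_coeffs 1 (tl cs)) - 4000000 * A"
      unfolding length_deriv_coeffs length_tl len diff_Suc_1 A(1) by simp
    then show ?thesis unfolding h'_def A(2) by simp
  qed
  have steep: "4 / 10000 * (y - x) \<le> h x - h y"
    if "x \<in> {?l..?r}" "y \<in> {?l..?r}" "x < y" for x y
  proof -
    have "?r < 1" using assms(2) by simp
    then have "(h has_real_derivative h' z) (at z)" if "x \<le> z" "z \<le> y" for z
      using that \<open>y \<in> {?l..?r}\<close> by (intro h) auto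
    then obtain z where z: "x < z" "z < y" "h y - h x = (y - x) * h' z"
      using MVT2[OF \<open>x < y\<close>, of h h'] by blast
    have "h' z \<le> - 4 / 10000" using z that by (intro h'_le) auto
    then have "(y - x) * h' z \<le> (y - x) * (- 4 / 10000)" using that by (intro mult_left_mono) auto
    then have "h y - h x \<le> (y - x) * (- 4 / 10000)" using z(3) by simp
    then show ?thesis by linarith
  qed
  have pos: "4 / 10000 \<le> h x" if x: "x \<in> {?l..?r}" for x
  proof -
    have "real_of_int (40000000000 div (10000 - r)) \<le> 40000000000 / (10000 - r)"
      using real_of_int_div4[of "40000000000" "10000 - r"] by simp
    also have "\<dots> = 4000000 / (1 - ?r)"
      using assms by (simp add: field_simps)
    finally have t: "real_of_int (40000000000 div (10000 - r)) \<le> 4000000 / (1 - ?r)" .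
    have "0 \<le> r" using x assms(1) by (simp add: field_simps)
    have "400 \<le> real_of_int (horner_lower r r (40000000000 div (10000 - r)) cs)"
      using checks(1) by linarith
    also have "\<dots> \<le> 1000000 * horner_sum of_int ?r cs + ?r ^ length cs * (4000000 / (1 - ?r))"
      by (rule horner_lower[OF _ _ _ t]) (use \<open>0 \<le> r\<close> in auto)
    also have "\<dots> = 1000000 * h ?r"
      unfolding h_def len by (simp only: distrib_left times_divide_eq_right mult_ac) simp
    finally have "4 / 10000 \<le> h ?r" by simp
    show ?thesis
    proof (cases "x = ?r")
      case True
      then show ?thesis using \<open>4 / 10000 \<le> h ?r\<close> by (simp only: True)
    next
      case False
      then have "x < ?r" "?r \<in> {?l..?r}" using x by auto
      have "0 \<le> 4 / 10000 * (?r - x)" using x by auto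
      also have "\<dots> \<le> h x - h ?r" by (rule steep[OF x]) fact+
      finally show ?thesis using \<open>4 / 10000 \<le> h ?r\<close> by (meson diff_ge_0_iff_ge order_trans)
    qed
  qed
  have "covered 1 (20000 * \<rho>) {x \<in> {?l..?r}. \<bar>series b x\<bar> \<le> \<rho>}" if b: "has_prefix p b" for b \<rho>
  proof (rule coveredI)
    fix x y
    assume xy: "x \<in> {x \<in> {?l..?r}. \<bar>series b x\<bar> \<le> \<rho>}" "y \<in> {x \<in> {?l..?r}. \<bar>series b x\<bar> \<le> \<rho>}" "x < y"
    have b': "b i \<in> {-1, 0, 1}" for i using b by (auto simp: has_prefix_def)
    have "y - x \<le> 2 * \<rho> / (1 / 10000)"
    proof (rule star_function_separates)
      show "(\<lambda>i. of_int (b i) * z ^ i) sums series b z" if "z \<in> {?l..?r}" for z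
        using b that assms by (intro series_sums) (auto simp: has_prefix_def)
      show "(\<lambda>i. (if i < length cs then of_int (cs ! i) else 4) / 4 * z ^ i) sums (h z / 4)"
        if "z \<in> {?l..?r}" for z
        using sums_divide[OF prefix_series_sums[of z cs 4], of 4] that assms by (simp add: h_def len)
      show "(if i < length cs then of_int (cs ! i) else 4) / 4 \<le> real_of_int (b i)" if "i < N" for i
        using b b'[of i] that
        by (auto simp: len cs_def N_def has_prefix_def nth_append)
      show "real_of_int (b i) \<le> (if i < length cs then of_int (cs ! i) else 4) / 4" if "N < i" for i
        using b'[of i] that by (auto simp: len)
      show "1 / 10000 \<le> h z / 4" if "z \<in> {?l..?r}" for z
        using pos[OF that] by simp
      show "1 / 10000 * (z' - z) \<le> h z / 4 - h z' / 4"
        if "z \<in> {?l..?r}" "z' \<in> {?l..?r}" "z < z'" for z z'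
        using steep[OF that] by simp
    qed (use xy assms in auto)
    then show "y - x \<le> 20000 * \<rho>" by simp
  qed auto
  then show ?thesis unfolding transversal_def by (intro exI allI impI)
qed

lemma check_transversal:
  assumes "check p l r c" "0 < l" "r < 10000"
  shows "transversal p (of_int l / 10000) (of_int r / 10000)"
  using assms
proof (induction p l r c rule: check.induct)
  case (1 p l r)
  show ?case by (rule transversal_Positive[OF _ 1(3) 1(1)]) (use 1(2) in linarith)
next
  case (2 p l r k a)
  show ?case by (rule transversal_Decreasing[OF 2(2,3,1)])
next
  case (3 p l r c)
  then have "transversal (map uminus p) (of_int l / 10000) (of_int r / 10000)" by simp
  then show ?case by (rule transversal_Flip) (use 3 in auto)
next
  case (4 p l r m c d)
  then have "transversal p (of_int l / 10000) (of_int m / 10000)"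
    "transversal p (of_int m / 10000) (of_int r / 10000)" by auto
  then show ?case by (rule transversal_Cut)
next
  case (5 p l r c d e)
  then have c: "check (p @ [-1]) l r c" "check (p @ [0]) l r d" "check (p @ [1]) l r e" by simp_all
  show ?case
    by (rule transversal_Branch) (use 5 c in blast)+
qed

text \<open>
  The certificate was found by a greedy search that branches only where no longer interval can be settled.
\<close>

lemma check_certificate:
  "check [1] 5000 6680 (Cut 6431 (Decreasing 3 1) (Branch (Branch (Branch (Branch (Flip Positive)
    (Cut 6504 (Flip Positive) (Cut 6576 (Flip Positive) (Flip (Decreasing 11 (-1))))) (Cut 6530
    (Decreasing 0 (-1)) (Branch (Flip Positive) (Cut 6575 (Decreasing 0 2) (Branch (Flip
    Positive) (Flip Positive) (Cut 6595 (Decreasing 0 1) (Branch (Flip Positive) (Cut 6619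
    (Flip Positive) (Cut 6643 (Flip Positive) (Cut 6667 (Flip Positive) (Flip Positive)))) (Cut
    6634 (Decreasing 0 (-1)) (Branch (Flip Positive) (Cut 6654 (Decreasing 0 2) (Branch (Flip
    Positive) (Flip Positive) (Cut 6661 (Decreasing 0 1) (Branch (Flip Positive) (Cut 6674
    (Flip Positive) (Flip Positive)) (Branch (Flip Positive) (Cut 6671 (Decreasing 0 3) (Branch
    (Flip Positive) (Flip Positive) (Cut 6677 (Decreasing 0 2) (Branch (Flip Positive) (Flip
    Positive) (Cut 6678 (Decreasing 0 1) (Branch (Flip Positive) (Flip Positive) (Branch (Flip
    Positive) (Decreasing 0 3) (Decreasing 0 (-3))))))))) (Cut 6678 (Decreasing 0 (-3)) (Branch
    (Flip Positive) (Decreasing 0 (-1)) (Decreasing 1 1)))))))) (Cut 6675 (Decreasing 0 (-4))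
    (Branch (Branch (Flip Positive) (Flip Positive) (Branch (Flip Positive) (Flip Positive)
    (Branch (Flip Positive) (Flip Positive) (Decreasing 0 3)))) (Decreasing 0 (-2)) (Decreasing
    1 (-1)))))))))) (Cut 6637 (Decreasing 0 (-4)) (Branch (Branch (Flip Positive) (Flip
    Positive) (Branch (Flip Positive) (Flip Positive) (Cut 6667 (Decreasing 0 3) (Branch (Flip
    Positive) (Flip Positive) (Decreasing 0 2))))) (Decreasing 0 (-2)) (Decreasing 1 (-1)))))))
    (Cut 6623 (Decreasing 1 2) (Branch (Branch (Flip Positive) (Flip Positive) (Cut 6654
    (Decreasing 0 1) (Branch (Flip Positive) (Cut 6659 (Flip Positive) (Cut 6665 (Flip
    Positive) (Cut 6671 (Flip Positive) (Cut 6678 (Flip Positive) (Flip Positive)))))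
    (Decreasing 0 (-1))))) (Decreasing 0 (-4)) (Decreasing 1 (-2)))) (Decreasing 2 3))
    (Decreasing 2 1) (Decreasing 3 3)) (Decreasing 3 2) Positive))"
  by code_simp

lemma transversality:
  "\<exists>k. \<forall>b \<rho>. range b \<subseteq> {-1, 0, 1} \<longrightarrow> b 0 = 1 \<longrightarrow>
     covered k (20000 * \<rho>) {x \<in> {1 / 2..0.668}. \<bar>series b x\<bar> \<le> \<rho>}"
  using check_transversal[OF check_certificate] by (simp add: transversal_def has_prefix_def imp_conjL)

section \<open>Separation of partial sums\<close>

text \<open>Extensional functions make this set finite, and words that agree on
  \<open>{1..n}\<close> are equal.\<close>

definition words :: "nat \<Rightarrow> (nat \<Rightarrow> nat) set" where
  "words n = {1..n} \<rightarrow>\<^sub>E {0, 1}"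

definition word_sum :: "(nat \<Rightarrow> nat) \<Rightarrow> nat \<Rightarrow> real \<Rightarrow> real" where
  "word_sum w n q = (\<Sum>i=1..n. real (w i) * q ^ i)"

lemma finite_words [simp]: "finite (words n)"
  by (simp add: words_def finite_PiE)

lemma card_words: "card (words n) = 2 ^ n"
  by (simp add: words_def card_PiE numeral_2_eq_2)

lemma words_le_1: "w \<in> words n \<Longrightarrow> i \<in> {1..n} \<Longrightarrow> w i = 0 \<or> w i = 1"
  by (auto simp: words_def PiE_iff)

lemma continuous_on_word_sum [continuous_intros]:
  "continuous_on S (\<lambda>q. word_sum w n q)"
  unfolding word_sum_def by (intro continuous_intros)

lemma measure_covered_le:
  assumes "covered k d S" "S \<in> sets lebesgue" "0 \<le> d"
  shows "measure lebesgue S \<le> real k * (2 * d)"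
proof -
  obtain T where T: "finite T" "card T \<le> k" "S \<subseteq> (\<Union>t\<in>T. cball t d)"
    using assms by (auto simp: covered_def)
  have "measure lebesgue S \<le> measure lebesgue (\<Union>t\<in>T. cball t d)"
    using T assms by (intro measure_mono_fmeasurable fmeasurable.finite_UN) auto
  also have "\<dots> \<le> (\<Sum>t\<in>T. measure lebesgue (cball t d))"
    using T by (intro measure_UNION_le) auto
  also have "\<dots> = real (card T) * (2 * d)"
    using assms by (simp add: cball_eq_atLeastAtMost)
  also have "\<dots> \<le> real k * (2 * d)"
    using T assms by (intro mult_right_mono) auto
  finally show ?thesis .
qed

text \<open>Differences of digits lie in {-1, 0, 1}; the common prefix cancels, and the power of q
  at the first disagreement factors out.\<close>

lemma word_sum_diff_eq_series:
  assumes "w k \<noteq> w' k" and same: "\<And>i. 1 \<le> i \<Longrightarrow> i < k \<Longrightarrow> w i = w' i"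
    and k: "k \<in> {1..n}" and w: "w \<in> words n" "w' \<in> words n"
  obtains b where "range b \<subseteq> {-1, 0, 1}" "b 0 = 1"
    "\<And>q. \<bar>word_sum w n q - word_sum w' n q\<bar> = \<bar>q\<bar> ^ k * \<bar>series b q\<bar>"
proof -
  \<comment> \<open>The factor w k - w' k is 1 or -1. It turns the leading coefficient into a
    square, hence 1, and disappears in the absolute value.\<close>
  define b where "b i = (if k + i \<le> n then (int (w k) - int (w' k)) * (int (w (k + i)) - int (w' (k + i))) else 0)" for i
  have wk: "w k = 0 \<or> w k = 1" "w' k = 0 \<or> w' k = 1" using words_le_1 w k by auto
  have "b i \<in> {-1, 0, 1}" for i
  proof (cases "k + i \<le> n")
    case True
    then have "w (k + i) = 0 \<or> w (k + i) = 1" "w' (k + i) = 0 \<or> w' (k + i) = 1"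
      using words_le_1[OF w(1), of "k + i"] words_le_1[OF w(2), of "k + i"] k by auto
    then show ?thesis using wk by (auto simp: b_def)
  qed (simp add: b_def)
  then have 1: "range b \<subseteq> {-1, 0, 1}" by blast
  have 2: "b 0 = 1" using wk assms(1) k by (auto simp: b_def)
  have "\<bar>word_sum w n q - word_sum w' n q\<bar> = \<bar>q\<bar> ^ k * \<bar>series b q\<bar>" for q
  proof -
    let ?s = "real (w k) - real (w' k)" and ?d = "\<lambda>i. real (w i) - real (w' i)"
    have "word_sum w n q - word_sum w' n q = (\<Sum>i=1..n. ?d i * q ^ i)"
      by (simp add: word_sum_def sum_subtractf left_diff_distrib)
    also have "\<dots> = (\<Sum>i=k..n. ?d i * q ^ i)"
      using k same by (intro sum.mono_neutral_right) auto
    also have "\<dots> = (\<Sum>i\<le>n - k. ?d (k + i) * q ^ (k + i))"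
      using k by (intro sum.reindex_bij_witness[of _ "\<lambda>i. k + i" "\<lambda>i. i - k"]) auto
    finally have *: "word_sum w n q - word_sum w' n q = (\<Sum>i\<le>n - k. ?d (k + i) * q ^ (k + i))" .
    have "series b q = (\<Sum>i\<le>n - k. of_int (b i) * q ^ i)"
      unfolding series_def by (rule suminf_finite) (auto simp: b_def)
    also have "\<dots> = ?s * (\<Sum>i\<le>n - k. ?d (k + i) * q ^ i)"
      unfolding sum_distrib_left using k by (intro sum.cong refl) (auto simp: b_def)
    finally have "\<bar>series b q\<bar> = \<bar>?s\<bar> * \<bar>\<Sum>i\<le>n - k. ?d (k + i) * q ^ i\<bar>"
      by (simp add: abs_mult)
    also have "\<bar>?s\<bar> = 1" using wk assms(1) by auto
    finally show ?thesis
      unfolding * by (simp add: power_add mult.left_commute flip: sum_distrib_left abs_mult power_abs)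
  qed
  with 1 2 show thesis by (rule that)
qed

text \<open>A pair is determined by \<open>w\<close> and the restriction of \<open>w'\<close> to
  \<open>{k..n}\<close>, since below k the second word repeats the first.\<close>

lemma card_common_prefix_le:
  assumes "k \<in> {1..n}"
  shows "card {(w, w') \<in> words n \<times> words n. \<forall>i. 1 \<le> i \<longrightarrow> i < k \<longrightarrow> w i = w' i} \<le> 2 ^ n * 2 ^ (Suc n - k)"
    (is "card ?P \<le> _")
proof -
  let ?f = "\<lambda>(w, w'). (w, restrict w' {k..n})"
  have "inj_on ?f ?P"
  proof (rule inj_onI)
    fix x y assume xy: "x \<in> ?P" "y \<in> ?P" "?f x = ?f y"
    obtain w v v' where x: "x = (w, v)" and y: "y = (w, v')"
      using xy(3) by (cases x, cases y) auto
    have w: "v \<in> words n" "v' \<in> words n" and eq: "restrict v {k..n} = restrict v' {k..n}"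
        "\<forall>i. 1 \<le> i \<longrightarrow> i < k \<longrightarrow> w i = v i" "\<forall>i. 1 \<le> i \<longrightarrow> i < k \<longrightarrow> w i = v' i"
      using xy by (auto simp: x y)
    have "v i = v' i" for i
    proof (cases "i \<in> {1..n}")
      case True
      then show ?thesis using eq(2,3) fun_cong[OF eq(1), of i] by (cases "i < k") auto
    next
      case False
      then show ?thesis using w unfolding words_def by (metis PiE_arb)
    qed
    then show "x = y" by (auto simp: x y)
  qed
  moreover have "?f ` ?P \<subseteq> words n \<times> ({k..n} \<rightarrow>\<^sub>E {0, 1})"
  proof (rule image_subsetI)
    fix x assume "x \<in> ?P"
    then obtain w w' where x: "x = (w, w')" "w \<in> words n" "w' \<in> words n" by blast
    have "w' i \<in> {0, 1}" if "i \<in> {k..n}" for i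
      using words_le_1[OF x(3), of i] that assms by simp
    then show "?f x \<in> words n \<times> ({k..n} \<rightarrow>\<^sub>E {0, 1})"
      using x by (simp add: restrict_PiE_iff)
  qed
  ultimately have "card ?P \<le> card (words n \<times> ({k..n} \<rightarrow>\<^sub>E {0, 1::nat}))"
    by (intro card_inj_on_le[of ?f]) (auto intro!: finite_cartesian_product finite_PiE)
  then show ?thesis by (simp add: card_words card_cartesian_product card_PiE numeral_2_eq_2)
qed

text \<open>Markov's inequality for the number of sets that contain x, a finite sum of indicator
  functions.\<close>

lemma markov_count:
  fixes A :: "'i \<Rightarrow> 'a::euclidean_space set"
  assumes "finite I" and A: "\<And>i. i \<in> I \<Longrightarrow> A i \<in> lmeasurable" and "0 < (m::real)"
  shows "{x. m \<le> card {i \<in> I. x \<in> A i}} \<in> lmeasurable"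
    and "m * measure lebesgue {x. m \<le> card {i \<in> I. x \<in> A i}} \<le> (\<Sum>i\<in>I. measure lebesgue (A i))"
proof -
  let ?f = "\<lambda>x. (\<Sum>i\<in>I. indicat_real (A i) x)"
  let ?B = "{x. m \<le> card {i \<in> I. x \<in> A i}}"
  have card: "real (card {i \<in> I. x \<in> A i}) = ?f x" for x
    using \<open>finite I\<close> by (simp add: indicator_def sum.If_cases Int_def)
  have ind: "integrable lebesgue (indicat_real S)" if "S \<in> lmeasurable" for S :: "'a set"
    using that unfolding fmeasurable_def infinity_ennreal_def[symmetric]
    by (intro integrable_real_indicator) blast+
  have int: "integrable lebesgue ?f"
    using A by (intro Bochner_Integration.integrable_sum ind)
  have B: "?B = {x \<in> space lebesgue. m \<le> ?f x}" by (simp flip: card)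
  have "?B \<in> sets lebesgue"
    unfolding B using borel_measurable_integrable[OF int] by measurable
  moreover have "?B \<subseteq> (\<Union>i\<in>I. A i)"
  proof
    fix x assume "x \<in> ?B"
    then have "{i \<in> I. x \<in> A i} \<noteq> {}" using \<open>0 < m\<close> by fastforce
    then show "x \<in> (\<Union>i\<in>I. A i)" by auto
  qed
  moreover have "(\<Union>i\<in>I. A i) \<in> lmeasurable" using assms by (intro fmeasurable.finite_UN) auto
  ultimately show lm: "?B \<in> lmeasurable" using fmeasurableI2 by blast
  have "m * measure lebesgue ?B = (\<integral>x. m * indicat_real ?B x \<partial>lebesgue)"
    using lm by simp
  also have "\<dots> \<le> (\<integral>x. ?f x \<partial>lebesgue)"
  proof (rule integral_mono[OF _ int])
    show "integrable lebesgue (\<lambda>x. m * indicat_real ?B x)"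
      by (rule integrable_mult_right[OF ind[OF lm]])
    show "m * indicat_real ?B x \<le> ?f x" for x
      unfolding card[symmetric] by (simp add: indicator_def)
  qed
  also have "\<dots> = (\<Sum>i\<in>I. integral\<^sup>L lebesgue (indicat_real (A i)))"
    using A by (intro Bochner_Integration.integral_sum ind)
  also have "\<dots> = (\<Sum>i\<in>I. measure lebesgue (A i))"
    by simp
  finally show "m * measure lebesgue ?B \<le> (\<Sum>i\<in>I. measure lebesgue (A i))" .
qed

section \<open>Parameters for which many pairs of words are close\<close>

definition close_pairs :: "nat \<Rightarrow> real \<Rightarrow> real \<Rightarrow> ((nat \<Rightarrow> nat) \<times> (nat \<Rightarrow> nat)) set" where
  "close_pairs n r q = {(w, w') \<in> words n \<times> words n. w \<noteq> w' \<and>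
     \<bar>word_sum w n q - word_sum w' n q\<bar> \<le> r}"

lemma lmeasurable_close:
  "{q \<in> {a..b}. \<bar>word_sum w n q - word_sum w' n q\<bar> \<le> r} \<in> lmeasurable"
proof -
  have "closed {q. \<bar>word_sum w n q - word_sum w' n q\<bar> \<le> r}"
    by (intro closed_Collect_le continuous_intros)
  then have "compact ({a..b} \<inter> {q. \<bar>word_sum w n q - word_sum w' n q\<bar> \<le> r})"
    by (intro compact_Int_closed) auto
  then show ?thesis by (simp add: lmeasurable_compact Int_def)
qed

text \<open>For q >= a the factor q ^ k is at least a ^ k, so closeness forces the normalised series
  to be at most r / a ^ k in absolute value, where transversality applies. The constant depends
  neither on the words and their length nor on \<open>a\<close>.\<close>

lemma measure_close_le:
  obtains K where "0 \<le> K"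
    "\<And>n k w w' a r. w \<in> words n \<Longrightarrow> w' \<in> words n \<Longrightarrow> k \<in> {1..n} \<Longrightarrow> w k \<noteq> w' k \<Longrightarrow>
       (\<And>i. 1 \<le> i \<Longrightarrow> i < k \<Longrightarrow> w i = w' i) \<Longrightarrow> 1 / 2 \<le> a \<Longrightarrow> 0 \<le> r \<Longrightarrow>
       measure lebesgue {q \<in> {a..0.668}. \<bar>word_sum w n q - word_sum w' n q\<bar> \<le> r} \<le> K * (r / a ^ k)"
proof -
  obtain k0 where k0: "\<And>b \<rho>. range b \<subseteq> {-1, 0, 1} \<Longrightarrow> b 0 = 1 \<Longrightarrow>
     covered k0 (20000 * \<rho>) {x \<in> {1 / 2..0.668}. \<bar>series b x\<bar> \<le> \<rho>}"
    using transversality by blast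
  show thesis
  \<comment> \<open>Each of the at most \<open>k0\<close> covering intervals has length 2 * 20000 *
    (r / a ^ k).\<close>
  proof (rule that[of "real k0 * 40000"])
    fix n k w w' and a r :: real
    assume w: "w \<in> words n" "w' \<in> words n" and k: "k \<in> {1..n}" "w k \<noteq> w' k"
      "\<And>i. 1 \<le> i \<Longrightarrow> i < k \<Longrightarrow> w i = w' i" and a: "1 / 2 \<le> a" and r: "0 \<le> r"
    let ?S = "{q \<in> {a..0.668}. \<bar>word_sum w n q - word_sum w' n q\<bar> \<le> r}"
    obtain b where b: "range b \<subseteq> {-1, 0, 1}" "b 0 = 1"
      "\<And>q. \<bar>word_sum w n q - word_sum w' n q\<bar> = \<bar>q\<bar> ^ k * \<bar>series b q\<bar>"
      using word_sum_diff_eq_series[OF k(2,3,1) w] by blast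
    have "?S \<subseteq> {x \<in> {1 / 2..0.668}. \<bar>series b x\<bar> \<le> r / a ^ k}"
    proof
      fix q assume q: "q \<in> ?S"
      have "\<bar>series b q\<bar> * a ^ k \<le> \<bar>series b q\<bar> * \<bar>q\<bar> ^ k"
        using q a by (intro mult_left_mono power_mono) auto
      also have "\<dots> \<le> r" using q b(3) by (simp add: mult.commute)
      finally show "q \<in> {x \<in> {1 / 2..0.668}. \<bar>series b x\<bar> \<le> r / a ^ k}"
        using q a by (simp add: pos_le_divide_eq)
    qed
    with k0[OF b(1,2)] have cov: "covered k0 (20000 * (r / a ^ k)) ?S"
      by (rule covered_mono[OF _ order_refl])
    have "0 \<le> 20000 * (r / a ^ k)" using a r by simp
    then have "measure lebesgue ?S \<le> real k0 * (2 * (20000 * (r / a ^ k)))"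
      by (rule measure_covered_le[OF cov fmeasurableD[OF lmeasurable_close]])
    also have "\<dots> = real k0 * 40000 * (r / a ^ k)" by simp
    finally show "measure lebesgue ?S \<le> real k0 * 40000 * (r / a ^ k)" .
  qed simp
qed

text \<open>Group the pairs by their first disagreement k: at most 2 ^ n * 2 ^ (n + 1 - k) pairs,
  each contributing at most K * r / a ^ k. This is 2 * K * 4 ^ n * r times (1 / (2 * a)) ^ k, a
  convergent geometric series because a > 1/2.\<close>

lemma sum_measure_close_le:
  assumes "1 / 2 < a"
  obtains M where "\<And>n r. 0 \<le> r \<Longrightarrow>
    (\<Sum>(w, w') \<in> {(w, w') \<in> words n \<times> words n. w \<noteq> w'}.
       measure lebesgue {q \<in> {a..0.668}. \<bar>word_sum w n q - word_sum w' n q\<bar> \<le> r}) \<le> M * (4 ^ n * r)"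
proof -
  obtain K where K: "0 \<le> K"
    "\<And>n k w w' a r. w \<in> words n \<Longrightarrow> w' \<in> words n \<Longrightarrow> k \<in> {1..n} \<Longrightarrow> w k \<noteq> w' k \<Longrightarrow>
       (\<And>i. 1 \<le> i \<Longrightarrow> i < k \<Longrightarrow> w i = w' i) \<Longrightarrow> 1 / 2 \<le> a \<Longrightarrow> 0 \<le> r \<Longrightarrow>
       measure lebesgue {q \<in> {a..0.668}. \<bar>word_sum w n q - word_sum w' n q\<bar> \<le> r} \<le> K * (r / a ^ k)"
    using measure_close_le by blast
  define t where "t = 1 / (2 * a)"
  have t: "0 \<le> t" "t < 1" using assms by (auto simp: t_def field_simps)
  show thesis
  proof (rule that[of "2 * K * (1 / (1 - t))"])
    fix n and r :: real assume r: "0 \<le> r"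
    let ?I = "{(w, w') \<in> words n \<times> words n. w \<noteq> w'}"
    let ?f = "\<lambda>(w, w'). measure lebesgue {q \<in> {a..0.668}. \<bar>word_sum w n q - word_sum w' n q\<bar> \<le> r}"
    define \<kappa> where "\<kappa> p = (LEAST i. 1 \<le> i \<and> fst p i \<noteq> snd p i)" for p :: "(nat \<Rightarrow> nat) \<times> (nat \<Rightarrow> nat)"
    have \<kappa>: "\<kappa> p \<in> {1..n} \<and> fst p (\<kappa> p) \<noteq> snd p (\<kappa> p) \<and> (\<forall>i. 1 \<le> i \<longrightarrow> i < \<kappa> p \<longrightarrow> fst p i = snd p i)"
      if "p \<in> ?I" for p
    proof -
      have "\<exists>i\<in>{1..n}. fst p i \<noteq> snd p i"
      proof (rule ccontr)
        assume "\<not> (\<exists>i\<in>{1..n}. fst p i \<noteq> snd p i)"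
        then have "fst p i = snd p i" if "i \<in> {1..n}" for i using that by blast
        moreover have "fst p \<in> words n" "snd p \<in> words n" using that by auto
        ultimately have "fst p = snd p" unfolding words_def by (metis PiE_ext)
        then show False using that by auto
      qed
      then obtain i where i: "i \<in> {1..n}" "fst p i \<noteq> snd p i" by blast
      then have "1 \<le> \<kappa> p \<and> fst p (\<kappa> p) \<noteq> snd p (\<kappa> p)"
        unfolding \<kappa>_def
        using LeastI[where P = "\<lambda>i. 1 \<le> i \<and> fst p i \<noteq> snd p i" and k = i] by simp
      moreover have "\<kappa> p \<le> i" unfolding \<kappa>_def using i by (simp add: Least_le)
      moreover have "fst p j = snd p j" if "1 \<le> j" "j < \<kappa> p" for j
        using not_less_Least[OF that(2)[unfolded \<kappa>_def]] that by auto
      ultimately show ?thesis using i by auto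
    qed
    have fin: "finite ?I" by (rule finite_subset[of _ "words n \<times> words n"]) auto
    have "sum ?f ?I = (\<Sum>k=1..n. sum ?f {p \<in> ?I. \<kappa> p = k})"
    proof (rule sum.group[symmetric, OF fin])
      show "\<kappa> ` ?I \<subseteq> {1..n}" using \<kappa> by blast
    qed simp
    also have "\<dots> \<le> (\<Sum>k=1..n. 2 * K * (4 ^ n * r) * t ^ k)"
    proof (rule sum_mono)
      fix k assume k: "k \<in> {1..n}"
      let ?P = "{(w, w') \<in> words n \<times> words n. \<forall>i. 1 \<le> i \<longrightarrow> i < k \<longrightarrow> w i = w' i}"
      have "?f p \<le> K * (r / a ^ k)" if "p \<in> {p \<in> ?I. \<kappa> p = k}" for p
      proof -
        have p: "p \<in> ?I" and pk: "\<kappa> p = k" using that by blast+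
        have "fst p \<in> words n" "snd p \<in> words n" using p by auto
        moreover have "k \<in> {1..n}" "fst p k \<noteq> snd p k" "\<And>i. 1 \<le> i \<Longrightarrow> i < k \<Longrightarrow> fst p i = snd p i"
          using \<kappa>[OF p] unfolding pk by blast+
        moreover have "1 / 2 \<le> a" using assms by simp
        ultimately show ?thesis
          unfolding case_prod_beta using r by (rule K(2))
      qed
      then have "sum ?f {p \<in> ?I. \<kappa> p = k} \<le> card {p \<in> ?I. \<kappa> p = k} * (K * (r / a ^ k))"
        by (rule sum_bounded_above)
      also have "\<dots> \<le> real (2 ^ n * 2 ^ (Suc n - k)) * (K * (r / a ^ k))"
      proof (intro mult_right_mono of_nat_mono)
        have "{p \<in> ?I. \<kappa> p = k} \<subseteq> ?P"
        proof
          fix p assume "p \<in> {p \<in> ?I. \<kappa> p = k}"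
          then have p: "p \<in> ?I" and pk: "\<kappa> p = k" by blast+
          have "\<forall>i. 1 \<le> i \<longrightarrow> i < k \<longrightarrow> fst p i = snd p i" using \<kappa>[OF p] unfolding pk by blast
          then show "p \<in> ?P" using p by (simp add: case_prod_beta)
        qed
        then have "card {p \<in> ?I. \<kappa> p = k} \<le> card ?P"
          by (intro card_mono) (rule finite_subset[of _ "words n \<times> words n"], auto)
        then show "card {p \<in> ?I. \<kappa> p = k} \<le> 2 ^ n * 2 ^ (Suc n - k)"
          using card_common_prefix_le[OF k] by (rule order_trans)
        show "0 \<le> K * (r / a ^ k)" using K(1) r assms by simp
      qed
      also have "\<dots> = 2 * K * (4 ^ n * r) * t ^ k"
      proof -
        have "(2::real) ^ (Suc n - k) = 2 ^ Suc n / 2 ^ k" using k by (intro power_diff) auto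
        moreover have "(4::real) ^ n = 2 ^ n * 2 ^ n" by (simp flip: power_mult_distrib)
        ultimately show ?thesis by (simp add: t_def power_divide power_mult_distrib)
      qed
      finally show "sum ?f {p \<in> ?I. \<kappa> p = k} \<le> 2 * K * (4 ^ n * r) * t ^ k" .
    qed
    also have "\<dots> = 2 * K * (4 ^ n * r) * (\<Sum>k=1..n. t ^ k)"
      by (rule sum_distrib_left[symmetric])
    also have "\<dots> \<le> 2 * K * (4 ^ n * r) * (1 / (1 - t))"
    proof (rule mult_left_mono)
      have "(\<Sum>k=1..n. t ^ k) \<le> (\<Sum>k. t ^ k)"
        using t by (intro sum_le_suminf summable_geometric) auto
      then show "(\<Sum>k=1..n. t ^ k) \<le> 1 / (1 - t)" using t by (simp add: suminf_geometric)
    qed (use K(1) r in simp)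
    also have "2 * K * (4 ^ n * r) * (1 / (1 - t)) = 2 * K * (1 / (1 - t)) * (4 ^ n * r)" by simp
    finally show "sum ?f ?I \<le> 2 * K * (1 / (1 - t)) * (4 ^ n * r)" .
  qed
qed

text \<open>Markov's inequality at the threshold 2 ^ n / 2. For r = c / 2 ^ n the measures sum up to
  at most a constant times 2 ^ n * c, so the powers of 2 cancel and the bound is uniform in
  n.\<close>

lemma many_close_pairs_measure_le:
  assumes "1 / 2 < a"
  obtains M where "\<And>n c. 0 < c \<Longrightarrow>
    {q \<in> {a..0.668}. 2 ^ n / 2 \<le> real (card (close_pairs n (c / 2 ^ n) q))} \<in> lmeasurable"
    "\<And>n c. 0 < c \<Longrightarrow> measure lebesgue
      {q \<in> {a..0.668}. 2 ^ n / 2 \<le> real (card (close_pairs n (c / 2 ^ n) q))} \<le> M * c"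
proof -
  obtain M where M: "\<And>n r. 0 \<le> r \<Longrightarrow>
    (\<Sum>(w, w') \<in> {(w, w') \<in> words n \<times> words n. w \<noteq> w'}.
       measure lebesgue {q \<in> {a..0.668}. \<bar>word_sum w n q - word_sum w' n q\<bar> \<le> r}) \<le> M * (4 ^ n * r)"
    using sum_measure_close_le[OF assms] by blast
  define I where "I n = {(w, w') \<in> words n \<times> words n. w \<noteq> w'}" for n
  define A where "A n r = (\<lambda>(w, w'). {q \<in> {a..0.668}. \<bar>word_sum w n q - word_sum w' n q\<bar> \<le> r})" for n r
  have finI: "finite (I n)" for n
    unfolding I_def by (rule finite_subset[of _ "words n \<times> words n"]) auto
  have lmA: "A n r p \<in> lmeasurable" for n r p
    unfolding A_def by (cases p) (simp only: prod.case lmeasurable_close)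
  have eq: "{q \<in> {a..0.668}. 2 ^ n / 2 \<le> real (card (close_pairs n r q))} =
      {q. 2 ^ n / 2 \<le> real (card {p \<in> I n. q \<in> A n r p})}" for n r
  proof -
    have 1: "{p \<in> I n. q \<in> A n r p} = close_pairs n r q" if "q \<in> {a..0.668}" for q
      using that by (auto simp: I_def A_def close_pairs_def)
    have 2: "{p \<in> I n. q \<in> A n r p} = {}" if "q \<notin> {a..0.668}" for q
      using that by (auto simp: A_def)
    \<comment> \<open>The threshold is positive, so parameters outside the interval, for which no
      pair is counted, never reach it.\<close>
    have 3: "\<not> (2::real) ^ n / 2 \<le> 0" by (simp add: not_le)
    show ?thesis
    proof (intro set_eqI)
      fix q
      show "q \<in> {q \<in> {a..0.668}. 2 ^ n / 2 \<le> real (card (close_pairs n r q))} \<longleftrightarrow>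
          q \<in> {q. 2 ^ n / 2 \<le> real (card {p \<in> I n. q \<in> A n r p})}"
      proof (cases "q \<in> {a..0.668}")
        case True
        show ?thesis unfolding mem_Collect_eq 1[OF True] using True by blast
      next
        case False
        show ?thesis unfolding mem_Collect_eq 2[OF False] card.empty of_nat_0 using False 3 by blast
      qed
    qed
  qed
  show thesis
  proof (rule that[of "2 * M"])
    fix n :: nat and c :: real assume c: "0 < c"
    show "{q \<in> {a..0.668}. 2 ^ n / 2 \<le> real (card (close_pairs n (c / 2 ^ n) q))} \<in> lmeasurable"
      unfolding eq by (rule markov_count(1)[OF finI lmA]) simp
    have "2 ^ n / 2 * measure lebesgue {q. 2 ^ n / 2 \<le> real (card {p \<in> I n. q \<in> A n (c / 2 ^ n) p})}
        \<le> (\<Sum>p\<in>I n. measure lebesgue (A n (c / 2 ^ n) p))"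
      by (rule markov_count(2)[OF finI lmA]) simp
    also have "\<dots> \<le> M * (4 ^ n * (c / 2 ^ n))"
      unfolding I_def A_def case_prod_beta
      by (rule M[unfolded case_prod_beta]) (use c in simp)
    also have "(4::real) ^ n * (c / 2 ^ n) = 2 ^ n * c"
    proof -
      have "(4::real) ^ n = 2 ^ n * 2 ^ n" by (simp flip: power_mult_distrib)
      then show ?thesis by simp
    qed
    also have "M * (2 ^ n * c) = 2 ^ n / 2 * (2 * M * c)" by simp
    finally show "measure lebesgue {q \<in> {a..0.668}. 2 ^ n / 2 \<le> real (card (close_pairs n (c / 2 ^ n) q))}
        \<le> 2 * M * c"
      unfolding eq by (subst (asm) mult_le_cancel_left_pos) auto
  qed
qed

text \<open>A word that is not the first component of a close pair has a sum farther than
  \<open>r\<close> from those of all other words, so the intervals of such words are pairwise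
  disjoint. At most as many words as there are close pairs are lost.\<close>

lemma measure_word_intervals_ge:
  assumes "0 < r"
  shows "r * (2 ^ n - real (card (close_pairs n r q))) \<le>
    measure lebesgue (\<Union>w\<in>words n. {word_sum w n q..word_sum w n q + r})"
proof -
  define J where "J = {w \<in> words n. \<forall>w'\<in>words n. w \<noteq> w' \<longrightarrow> r < \<bar>word_sum w n q - word_sum w' n q\<bar>}"
  let ?U = "\<lambda>w. {word_sum w n q..word_sum w n q + r}"
  have finJ: "finite J" by (rule finite_subset[of _ "words n"]) (auto simp: J_def)
  have "words n \<subseteq> J \<union> fst ` close_pairs n r q"
    by (force simp: J_def close_pairs_def not_less)
  moreover have fin: "finite (close_pairs n r q)"
    by (rule finite_subset[of _ "words n \<times> words n"]) (auto simp: close_pairs_def)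
  ultimately have "card (words n) \<le> card (J \<union> fst ` close_pairs n r q)"
    using finJ by (intro card_mono) auto
  also have "\<dots> \<le> card J + card (close_pairs n r q)"
    using card_Un_le card_image_le[OF fin, of fst] by (meson add_left_mono order_trans)
  finally have "real (2 ^ n) \<le> real (card J + card (close_pairs n r q))"
    unfolding card_words of_nat_le_iff .
  then have "2 ^ n - real (card (close_pairs n r q)) \<le> real (card J)" by simp
  then have "r * (2 ^ n - real (card (close_pairs n r q))) \<le> r * real (card J)"
    using assms by (intro mult_left_mono) auto
  also have "\<dots> = (\<Sum>w\<in>J. measure lebesgue (?U w))"
    using assms by simp
  also have "\<dots> = measure lebesgue (\<Union>w\<in>J. ?U w)"
  proof (rule measure_finite_Union[symmetric])
    show "disjoint_family_on ?U J"
      unfolding disjoint_family_on_def J_def by fastforce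
  qed (use finJ assms in auto)
  also have "\<dots> \<le> measure lebesgue (\<Union>w\<in>words n. ?U w)"
    by (intro measure_mono_fmeasurable fmeasurable.finite_UN sets.finite_UN finJ) (auto simp: J_def)
  finally show ?thesis .
qed

text \<open>By Vitali, disjoint balls inside an open \<open>U\<close> slightly larger than
  \<open>E\<close> cover \<open>E\<close> up to a null set. In each ball \<open>E\<close> occupies
  at most the fraction \<theta>, so |E| <= \<theta> * |U|, which is impossible if |E| > 0 and |U| is
  close to |E|.\<close>

lemma negligible_if_density_less_1:
  fixes E :: "'a::euclidean_space set"
  assumes E: "E \<in> lmeasurable" and "0 \<le> \<theta>" "\<theta> < 1"
    and dens: "\<And>x d. x \<in> E \<Longrightarrow> 0 < d \<Longrightarrow> \<exists>r. 0 < r \<and> r < d \<and>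
      measure lebesgue (E \<inter> cball x r) \<le> \<theta> * measure lebesgue (cball x r)"
  shows "negligible E"
proof (rule ccontr)
  assume "\<not> negligible E"
  then have pos: "0 < measure lebesgue E"
    using E by (metis negligible_iff_measure0 zero_less_measure_iff)
  \<comment> \<open>This excess of \<open>U\<close> gives \<theta> * |U| <= \<theta> * (2 -
    \<theta>) * |E|, where \<theta> * (2 - \<theta>) = 1 - (1 - \<theta>) ^ 2 < 1.\<close>
  have e: "0 < (1 - \<theta>) * measure lebesgue E" using pos \<open>\<theta> < 1\<close> by (intro mult_pos_pos) auto
  obtain U where U: "open U" "E \<subseteq> U" and UE: "U - E \<in> lmeasurable"
      "emeasure lebesgue (U - E) < ennreal ((1 - \<theta>) * measure lebesgue E)"
    by (rule sets_lebesgue_outer_open[OF fmeasurableD[OF E] e])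
  have U_eq: "U = E \<union> (U - E)" using U by blast
  have Ul: "U \<in> lmeasurable" by (subst U_eq) (intro fmeasurable.Un E UE)
  have "measure lebesgue (U - E) < (1 - \<theta>) * measure lebesgue E"
    using UE(2) unfolding emeasure_eq_measure2[OF UE(1)] by (subst (asm) ennreal_less_iff) auto
  moreover have "measure lebesgue U \<le> measure lebesgue E + measure lebesgue (U - E)"
    by (subst U_eq) (rule measure_Un_le[OF fmeasurableD[OF E] fmeasurableD[OF UE(1)]])
  ultimately have U4: "measure lebesgue U \<le> measure lebesgue E + (1 - \<theta>) * measure lebesgue E"
    by linarith
  define K where "K = {(x, r). x \<in> E \<and> 0 < r \<and> cball x r \<subseteq> U \<and>
      measure lebesgue (E \<inter> cball x r) \<le> \<theta> * measure lebesgue (cball x r)}"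
  have K: "\<exists>i. i \<in> K \<and> x \<in> cball (fst i) (snd i) \<and> snd i < d" if xE: "x \<in> E" and d0: "0 < d" for x d
  proof -
    have "x \<in> U" using U(2) xE by blast
    then obtain e where "0 < e" "cball x e \<subseteq> U"
      using U(1)[unfolded open_contains_cball, rule_format, of x] by blast
    moreover obtain r where "0 < r" "r < min d e"
        "measure lebesgue (E \<inter> cball x r) \<le> \<theta> * measure lebesgue (cball x r)"
      using dens[OF xE, of "min d e"] d0 \<open>0 < e\<close> by auto
    moreover from \<open>r < min d e\<close> have "cball x r \<subseteq> cball x e" by (intro subset_cball) simp
    ultimately have "(x, r) \<in> K" using xE unfolding K_def by blast
    then show ?thesis using \<open>r < min d e\<close> \<open>0 < r\<close> by (intro exI[of _ "(x, r)"]) auto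
  qed
  have K0: "0 < snd i" if "i \<in> K" for i using that by (auto simp: K_def)
  let ?B = "\<lambda>i. cball (fst i :: 'a) (snd i :: real)"
  obtain C where C: "countable C" "C \<subseteq> K"
     "pairwise (\<lambda>i j. disjnt (?B i) (?B j)) C" "negligible (E - (\<Union>i \<in> C. ?B i))"
    by (rule Vitali_covering_theorem_cballs[of K snd E fst, OF K0 K])
  have dj: "disjoint_family_on ?B C"
    using C(3) by (auto simp: disjoint_family_on_def pairwise_def disjnt_def)
  have Es: "E \<in> sets lebesgue" using E by auto
  have Bs: "(\<Union>i\<in>C. ?B i) \<in> sets lebesgue"
    by (intro sets.countable_UN' C(1)) auto
  have EBs: "(\<Union>i\<in>C. E \<inter> ?B i) \<in> sets lebesgue"
    by (intro sets.countable_UN' C(1)) (use Es in auto)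
  have Ds: "E - (\<Union>i\<in>C. ?B i) \<in> sets lebesgue"
    by (intro sets.Diff Es Bs)
  have "emeasure lebesgue E \<le> emeasure lebesgue ((\<Union>i\<in>C. E \<inter> ?B i) \<union> (E - (\<Union>i \<in> C. ?B i)))"
    by (intro emeasure_mono sets.Un EBs Ds) blast
  also have "\<dots> \<le> emeasure lebesgue (\<Union>i\<in>C. E \<inter> ?B i) + emeasure lebesgue (E - (\<Union>i \<in> C. ?B i))"
    by (rule emeasure_subadditive[OF EBs Ds])
  also have "emeasure lebesgue (E - (\<Union>i \<in> C. ?B i)) = 0"
    using C(4) unfolding negligible_iff_emeasure0[OF Ds] .
  also have "emeasure lebesgue (\<Union>i\<in>C. E \<inter> ?B i) = (\<integral>\<^sup>+ i. emeasure lebesgue (E \<inter> ?B i) \<partial>count_space C)"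
  proof (intro emeasure_UN_countable C(1))
    show "disjoint_family_on (\<lambda>i. E \<inter> ?B i) C" using dj unfolding disjoint_family_on_def by blast
  qed (use Es in auto)
  also have "\<dots> \<le> (\<integral>\<^sup>+ i. ennreal \<theta> * emeasure lebesgue (?B i) \<partial>count_space C)"
  proof (rule nn_integral_mono)
    fix i assume "i \<in> space (count_space C)"
    then have "i \<in> K" using C(2) by auto
    then have "measure lebesgue (E \<inter> ?B i) \<le> \<theta> * measure lebesgue (?B i)" by (auto simp: K_def)
    then have "ennreal (measure lebesgue (E \<inter> ?B i)) \<le> ennreal (\<theta> * measure lebesgue (?B i))"
      by (rule ennreal_leI)
    moreover have "E \<inter> ?B i \<in> lmeasurable" "?B i \<in> lmeasurable"
      using E by (auto intro: fmeasurable.Int)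
    ultimately show "emeasure lebesgue (E \<inter> ?B i) \<le> ennreal \<theta> * emeasure lebesgue (?B i)"
      using \<open>0 \<le> \<theta>\<close> by (simp only: emeasure_eq_measure2 ennreal_mult measure_nonneg)
  qed
  also have "\<dots> = ennreal \<theta> * (\<integral>\<^sup>+ i. emeasure lebesgue (?B i) \<partial>count_space C)"
    by (rule nn_integral_cmult) simp
  also have "(\<integral>\<^sup>+ i. emeasure lebesgue (?B i) \<partial>count_space C) = emeasure lebesgue (\<Union>i\<in>C. ?B i)"
    by (intro emeasure_UN_countable[symmetric] C(1) dj) auto
  also have "ennreal \<theta> * emeasure lebesgue (\<Union>i\<in>C. ?B i) \<le> ennreal \<theta> * emeasure lebesgue U"
  proof (intro mult_left_mono emeasure_mono fmeasurableD[OF Ul])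
    show "(\<Union>i\<in>C. ?B i) \<subseteq> U" using C(2) unfolding K_def by fastforce
  qed simp
  finally have "ennreal (measure lebesgue E) \<le> ennreal (\<theta> * measure lebesgue U)"
    using Ul E \<open>0 \<le> \<theta>\<close> by (simp only: emeasure_eq_measure2 ennreal_mult measure_nonneg add_0_right)
  then have "measure lebesgue E \<le> \<theta> * measure lebesgue U"
    using \<open>0 \<le> \<theta>\<close> by (subst (asm) ennreal_le_iff) auto
  also have "\<dots> \<le> \<theta> * (measure lebesgue E + (1 - \<theta>) * measure lebesgue E)"
    using U4 \<open>0 \<le> \<theta>\<close> by (intro mult_left_mono) auto
  finally have "(1 - \<theta>) * (1 - \<theta>) * measure lebesgue E \<le> 0"
    by (simp add: algebra_simps)
  moreover have "0 < (1 - \<theta>) * (1 - \<theta>) * measure lebesgue E"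
    using pos \<open>\<theta> < 1\<close> by simp
  ultimately show False by simp
qed

text \<open>The bound c <= 1 places intervals of length c / 2 ^ n inside those of
  \<open>hit 1 n q\<close>.\<close>

definition separated_often :: "real \<Rightarrow> bool" where
  "separated_often q \<longleftrightarrow> (\<exists>c>0. c \<le> 1 \<and>
     (\<exists>\<^sub>\<infinity>n. real (card (close_pairs n (c / 2 ^ n) q)) < 2 ^ n / 2))"

text \<open>If the property fails at q, then for each admissible c there are many close pairs at
  every large level n. The sets of such parameters have measure at most M * c for each n, hence so
  has their lower limit, an increasing union of intersections; and c can be taken arbitrarily
  small.\<close>

lemma negligible_not_separated_often:
  assumes "1 / 2 < a"
  shows "negligible {q \<in> {a..0.668}. \<not> separated_often q}"
  unfolding negligible_outer_le
proof (intro allI impI)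
  fix e :: real assume e: "0 < e"
  obtain M where M: "\<And>n c. 0 < c \<Longrightarrow>
    {q \<in> {a..0.668}. 2 ^ n / 2 \<le> real (card (close_pairs n (c / 2 ^ n) q))} \<in> lmeasurable"
    "\<And>n c. 0 < c \<Longrightarrow> measure lebesgue
      {q \<in> {a..0.668}. 2 ^ n / 2 \<le> real (card (close_pairs n (c / 2 ^ n) q))} \<le> M * c"
    using many_close_pairs_measure_le[OF assms] by blast
  \<comment> \<open>With |M| + 1 the denominator is positive whatever the sign of \<open>M\<close>,
    and M * c <= e.\<close>
  define c where "c = min 1 (e / (\<bar>M\<bar> + 1))"
  have c: "0 < c" "c \<le> 1" using e by (auto simp: c_def)
  have "M * c \<le> (\<bar>M\<bar> + 1) * (e / (\<bar>M\<bar> + 1))"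
    using c e by (intro mult_mono) (auto simp: c_def)
  then have Mc: "M * c \<le> e" by simp
  define G where "G n = {q \<in> {a..0.668}. 2 ^ n / 2 \<le> real (card (close_pairs n (c / 2 ^ n) q))}" for n
  have G: "G n \<in> lmeasurable" for n
    unfolding G_def by (rule M(1)[OF c(1)])
  have Ge: "measure lebesgue (G n) \<le> e" for n
    unfolding G_def using M(2)[OF c(1), of n] Mc by (rule order_trans)
  define F where "F m = (\<Inter>n\<in>{m..}. G n)" for m
  have F: "F m \<in> sets lebesgue" for m
    unfolding F_def using G by (intro sets.countable_INT') auto
  have "incseq F" unfolding F_def incseq_def by fastforce
  have "emeasure lebesgue (\<Union>m. F m) = (SUP m. emeasure lebesgue (F m))"
    using F \<open>incseq F\<close> by (intro SUP_emeasure_incseq[symmetric]) auto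
  also have "\<dots> \<le> ennreal e"
  proof (rule SUP_least)
    fix m
    have "emeasure lebesgue (F m) \<le> emeasure lebesgue (G m)"
      using G by (intro emeasure_mono) (auto simp: F_def)
    also have "\<dots> \<le> ennreal e" unfolding emeasure_eq_measure2[OF G] by (rule ennreal_leI[OF Ge])
    finally show "emeasure lebesgue (F m) \<le> ennreal e" .
  qed
  finally have le: "emeasure lebesgue (\<Union>m. F m) \<le> ennreal e" .
  then have lm: "(\<Union>m. F m) \<in> lmeasurable"
    using F by (intro fmeasurableI) (auto simp: le_less_trans[OF _ ennreal_less_top])
  show "\<exists>T. {q \<in> {a..0.668}. \<not> separated_often q} \<subseteq> T \<and> T \<in> lmeasurable \<and> measure lebesgue T \<le> e"
  proof (intro exI conjI)
    show "{q \<in> {a..0.668}. \<not> separated_often q} \<subseteq> (\<Union>m. F m)"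
    proof
      fix q assume q: "q \<in> {q \<in> {a..0.668}. \<not> separated_often q}"
      then have "\<not> (\<exists>\<^sub>\<infinity>n. real (card (close_pairs n (c / 2 ^ n) q)) < 2 ^ n / 2)"
        using c unfolding separated_often_def by blast
      then have "\<forall>\<^sub>\<infinity>n. 2 ^ n / 2 \<le> real (card (close_pairs n (c / 2 ^ n) q))"
        by (simp add: not_INFM not_less)
      then obtain m where "\<forall>n\<ge>m. 2 ^ n / 2 \<le> real (card (close_pairs n (c / 2 ^ n) q))"
        unfolding MOST_nat_le by blast
      then show "q \<in> (\<Union>m. F m)" using q by (auto simp: F_def G_def)
    qed
    show "measure lebesgue (\<Union>m. F m) \<le> e"
      using le lm e by (simp only: emeasure_eq_measure2 ennreal_le_iff)
  qed (rule lm)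
qed

section \<open>Points approximated infinitely often\<close>

text \<open>The sum of q ^ i over i >= 1, the largest value of an expansion; for q = 1 / \<beta> it
  is the right end of \<open>I_beta \<beta>\<close>.\<close>

definition tail :: "real \<Rightarrow> real" where
  "tail q = q / (1 - q)"

text \<open>The bound \<open>q ^ n * tail q\<close> keeps the remainder within reach of the later
  digits, so that the word can be continued to an expansion.\<close>

definition hit :: "nat \<Rightarrow> nat \<Rightarrow> real \<Rightarrow> real set" where
  "hit C n q = (\<Union>w\<in>words n. {word_sum w n q..word_sum w n q + min (real C / 2 ^ n) (q ^ n * tail q)})"

text \<open>The constant may depend on the point, since prepending a word enlarges it. As
  \<open>C\<close> is a natural number, the union over it is countable.\<close>

definition hit_often :: "real \<Rightarrow> real set" where
  "hit_often q = {x. \<exists>C. \<exists>\<^sub>\<infinity>n. x \<in> hit C n q}"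

definition append_word :: "nat \<Rightarrow> nat \<Rightarrow> (nat \<Rightarrow> nat) \<Rightarrow> (nat \<Rightarrow> nat) \<Rightarrow> nat \<Rightarrow> nat" where
  "append_word k n w v = (\<lambda>i\<in>{1..k + n}. if i \<le> k then w i else v (i - k))"

lemma append_word_in_words:
  assumes "w \<in> words k" "v \<in> words n"
  shows "append_word k n w v \<in> words (k + n)"
  unfolding words_def append_word_def
proof (rule restrict_PiE_iff[THEN iffD2], rule ballI)
  fix i assume i: "i \<in> {1..k + n}"
  show "(if i \<le> k then w i else v (i - k)) \<in> {0, 1}"
  proof (cases "i \<le> k")
    case True
    then show ?thesis using words_le_1[OF assms(1), of i] i by simp
  next
    case False
    then show ?thesis using words_le_1[OF assms(2), of "i - k"] i by (simp add: le_diff_conv)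
  qed
qed

lemma word_sum_cong:
  "(\<And>i. i \<in> {1..n} \<Longrightarrow> w i = v i) \<Longrightarrow> word_sum w n q = word_sum v n q"
  unfolding word_sum_def by (rule sum.cong) auto

lemma word_sum_append:
  "word_sum (append_word k n w v) (k + n) q = word_sum w k q + q ^ k * word_sum v n q"
proof -
  have "word_sum (append_word k n w v) (k + n) q =
      (\<Sum>i=1..k. real (append_word k n w v i) * q ^ i) + (\<Sum>i=k+1..k+n. real (append_word k n w v i) * q ^ i)"
    unfolding word_sum_def by (rule sum.ub_add_nat) simp
  also have "(\<Sum>i=1..k. real (append_word k n w v i) * q ^ i) = word_sum w k q"
    unfolding word_sum_def append_word_def by (intro sum.cong) auto
  also have "(\<Sum>i=k+1..k+n. real (append_word k n w v i) * q ^ i)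
      = (\<Sum>i=1..n. real (append_word k n w v (i + k)) * q ^ (i + k))"
    using sum.shift_bounds_cl_nat_ivl[of "\<lambda>i. real (append_word k n w v i) * q ^ i" 1 k n]
    by (simp add: add.commute)
  also have "\<dots> = q ^ k * word_sum v n q"
    unfolding word_sum_def append_word_def sum_distrib_left
    by (intro sum.cong) (auto simp: power_add)
  finally show ?thesis .
qed

lemma tail_scale:
  assumes "q < 1"
  shows "q + q * tail q = tail q"
  using assms by (simp add: tail_def field_simps)

lemma word_sum_nonneg:
  assumes "0 \<le> q"
  shows "0 \<le> word_sum w n q"
  unfolding word_sum_def using assms by (intro sum_nonneg) auto

text \<open>The word with all digits 1 has the largest sum, and for it equality holds by
  \<open>tail_scale\<close>.\<close>

lemma word_sum_plus_tail_le:
  assumes "0 \<le> q" "q < 1" "w \<in> words n"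
  shows "word_sum w n q + q ^ n * tail q \<le> tail q"
proof -
  have "word_sum w n q \<le> (\<Sum>i=1..n. q ^ i)"
    unfolding word_sum_def
  proof (rule sum_mono)
    fix i assume "i \<in> {1..n}"
    then have "w i = 0 \<or> w i = 1" using words_le_1[OF assms(3)] by blast
    then show "real (w i) * q ^ i \<le> q ^ i" using assms by auto
  qed
  moreover have "(\<Sum>i=1..n. q ^ i) + q ^ n * tail q = tail q"
  proof (induction n)
    case (Suc n)
    have "q ^ n * (q + q * tail q) = q ^ n * tail q" by (simp only: tail_scale[OF assms(2)])
    then show ?case using Suc by (simp add: algebra_simps)
  qed simp
  ultimately show ?thesis by linarith
qed

lemma tail_ge_1: "1 / 2 < q \<Longrightarrow> q < 1 \<Longrightarrow> 1 \<le> tail q"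
  by (simp add: tail_def field_simps)

lemma hitE:
  assumes "x \<in> hit C n q"
  obtains w where "w \<in> words n" "0 \<le> x - word_sum w n q"
    "x - word_sum w n q \<le> real C / 2 ^ n" "x - word_sum w n q \<le> q ^ n * tail q"
proof -
  obtain w where w: "w \<in> words n"
      "x \<in> {word_sum w n q..word_sum w n q + min (real C / 2 ^ n) (q ^ n * tail q)}"
    using assms unfolding hit_def by blast
  show thesis by (rule that[OF w(1)]) (use w(2) in auto)
qed

lemma hit_subset:
  assumes "1 / 2 < q" "q < 1"
  shows "hit C n q \<subseteq> {0..tail q}"
proof
  fix x assume "x \<in> hit C n q"
  then obtain w where "w \<in> words n" "word_sum w n q \<le> x" "x \<le> word_sum w n q + q ^ n * tail q"
    by (auto simp: hit_def)
  moreover have "0 \<le> word_sum w n q" using assms by (intro word_sum_nonneg) simp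
  moreover have "word_sum w n q + q ^ n * tail q \<le> tail q"
    using assms \<open>w \<in> words n\<close> by (intro word_sum_plus_tail_le) auto
  ultimately show "x \<in> {0..tail q}" by simp
qed

lemma hit_often_subset:
  assumes "1 / 2 < q" "q < 1"
  shows "hit_often q \<subseteq> {0..tail q}"
  using hit_subset[OF assms] unfolding hit_often_def by (blast dest: INFM_EX)

lemma hit_lmeasurable: "hit C n q \<in> lmeasurable"
  unfolding hit_def by (intro fmeasurable.finite_UN) auto

lemma hit_often_borel: "hit_often q \<in> sets borel"
proof -
  have eq: "hit_often q = (\<Union>C. \<Inter>m. \<Union>n\<in>{m..}. hit C n q)"
    unfolding hit_often_def INFM_nat_le by blast
  have "hit C n q \<in> sets borel" for C n
    unfolding hit_def by (intro sets.finite_UN) auto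
  then show ?thesis
    unfolding eq by (intro sets.countable_UN sets.countable_INT sets.countable_UN' image_subsetI) auto
qed

lemma hit_often_lmeasurable:
  assumes "1 / 2 < q" "q < 1"
  shows "hit_often q \<in> lmeasurable"
proof (rule fmeasurableI2)
  show "hit_often q \<subseteq> {0..tail q}" by (rule hit_often_subset[OF assms])
qed (use hit_often_borel in auto)

text \<open>Prepending \<open>w\<close> multiplies the remainder by q ^ k <= 1, while the target 1 /
  2 ^ n shrinks by the factor 2 ^ k; the constant C * 2 ^ k absorbs this.\<close>

lemma hit_often_invariant:
  assumes q: "1 / 2 < q" "q < 1" and w: "w \<in> words k" and x: "x \<in> hit_often q"
  shows "word_sum w k q + q ^ k * x \<in> hit_often q"
proof -
  obtain C where C: "\<exists>\<^sub>\<infinity>n. x \<in> hit C n q" using x by (auto simp: hit_often_def)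
  have step: "word_sum w k q + q ^ k * x \<in> hit (C * 2 ^ k) (k + n) q" if x_hit: "x \<in> hit C n q" for n
  proof -
    obtain v where v: "v \<in> words n" "0 \<le> x - word_sum v n q"
        "x - word_sum v n q \<le> real C / 2 ^ n" "x - word_sum v n q \<le> q ^ n * tail q"
      by (rule hitE[OF x_hit])
    let ?u = "append_word k n w v"
    have diff: "word_sum w k q + q ^ k * x - word_sum ?u (k + n) q = q ^ k * (x - word_sum v n q)"
      by (simp add: word_sum_append algebra_simps)
    have "0 \<le> q ^ k * (x - word_sum v n q)" using v(2) q by simp
    moreover have "q ^ k * (x - word_sum v n q) \<le> real (C * 2 ^ k) / 2 ^ (k + n)"
    proof -
      have "q ^ k * (x - word_sum v n q) \<le> 1 * (real C / 2 ^ n)"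
        using q v by (intro mult_mono power_le_one) auto
      then show ?thesis by (simp add: power_add)
    qed
    moreover have "q ^ k * (x - word_sum v n q) \<le> q ^ (k + n) * tail q"
    proof -
      have "q ^ k * (x - word_sum v n q) \<le> q ^ k * (q ^ n * tail q)"
        using q v by (intro mult_left_mono) auto
      then show ?thesis by (simp add: power_add mult.assoc)
    qed
    ultimately show ?thesis
      using append_word_in_words[OF w v(1)] unfolding diff[symmetric] hit_def by fastforce
  qed
  have "\<exists>\<^sub>\<infinity>n. word_sum w k q + q ^ k * x \<in> hit (C * 2 ^ k) n q"
    unfolding INFM_nat_le
  proof
    fix m
    obtain n where "m \<le> n" "x \<in> hit C n q" using C unfolding INFM_nat_le by blast
    then show "\<exists>n\<ge>m. word_sum w k q + q ^ k * x \<in> hit (C * 2 ^ k) n q"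
      using step[of n] by (intro exI[of _ "k + n"]) auto
  qed
  then show ?thesis unfolding hit_often_def by blast
qed

text \<open>Digits are chosen greedily: if y < q, digit 0 leaves y / q < 1 <= tail q, where q > 1/2
  enters; otherwise digit 1 leaves y / q - 1 <= tail q, because tail q = q + q * tail q.\<close>

lemma ex_word_remainder:
  assumes q: "1 / 2 < q" "q < 1" and x: "x \<in> {0..tail q}"
  obtains w y where "w \<in> words n" "y \<in> {0..tail q}" "x = word_sum w n q + q ^ n * y"
proof -
  have "\<exists>w y. w \<in> words n \<and> y \<in> {0..tail q} \<and> x = word_sum w n q + q ^ n * y"
  proof (induction n)
    case 0
    then show ?case using x by (auto simp: words_def word_sum_def)
  next
    case (Suc n)
    then obtain w y where w: "w \<in> words n" and y: "y \<in> {0..tail q}" "x = word_sum w n q + q ^ n * y"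
      by blast
    define d :: nat where "d = (if y < q then 0 else 1)"
    have d: "y / q - real d \<in> {0..tail q}"
    proof (cases "y < q")
      case True
      then have "y / q \<le> 1" "0 \<le> y / q" using q y by simp_all
      then show ?thesis using True tail_ge_1[OF q] by (simp add: d_def)
    next
      case False
      then have "1 \<le> y / q" using q by simp
      moreover have "y \<le> q * (1 + tail q)" using tail_scale[OF q(2)] y by (simp add: algebra_simps)
      then have "y / q \<le> 1 + tail q" using q by (simp add: field_simps)
      ultimately show ?thesis using False by (simp add: d_def)
    qed
    let ?v = "\<lambda>i\<in>{1..1::nat}. d"
    have v: "?v \<in> words 1" by (auto simp: words_def d_def)
    have "word_sum ?v 1 q = real d * q" by (simp add: word_sum_def)
    then have "x = word_sum (append_word n 1 w ?v) (n + 1) q + q ^ (n + 1) * (y / q - real d)"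
      unfolding word_sum_append y(2) using q by (simp add: algebra_simps)
    then show ?case using append_word_in_words[OF w v] d by (intro exI conjI) auto
  qed
  then show thesis using that by blast
qed

text \<open>For infinitely many n, at least half of the 2 ^ n intervals of length c / 2 ^ n are
  disjoint, so \<open>hit 1 n q\<close> has measure at least c / 2. The upper limit of these sets
  inherits the bound.\<close>

lemma measure_hit_often_pos:
  assumes q: "1 / 2 < q" "q < 1" and sep: "separated_often q"
  shows "0 < measure lebesgue (hit_often q)"
proof -
  obtain c where c: "0 < c" "c \<le> 1"
    and inf: "\<exists>\<^sub>\<infinity>n. real (card (close_pairs n (c / 2 ^ n) q)) < 2 ^ n / 2"
    using sep by (auto simp: separated_often_def)
  have hit: "c / 2 \<le> measure lebesgue (hit 1 n q)"
    if n: "real (card (close_pairs n (c / 2 ^ n) q)) < 2 ^ n / 2" for n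
  proof -
    have "c / 2 = c / 2 ^ n * (2 ^ n / 2)" by simp
    also have "\<dots> \<le> c / 2 ^ n * (2 ^ n - real (card (close_pairs n (c / 2 ^ n) q)))"
      using n c by (intro mult_left_mono) auto
    also have "\<dots> \<le> measure lebesgue (\<Union>w\<in>words n. {word_sum w n q..word_sum w n q + c / 2 ^ n})"
      using c by (intro measure_word_intervals_ge) simp
    also have "\<dots> \<le> measure lebesgue (hit 1 n q)"
    proof (rule measure_mono_fmeasurable)
      have "c / 2 ^ n \<le> 1 / 2 ^ n" using c by (intro divide_right_mono) auto
      moreover have "1 / 2 ^ n \<le> q ^ n * tail q"
      proof -
        have "(1 / 2) ^ n * 1 \<le> q ^ n * tail q"
          using q tail_ge_1[OF q] by (intro mult_mono power_mono) auto
        then show ?thesis by (simp add: power_divide)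
      qed
      ultimately show "(\<Union>w\<in>words n. {word_sum w n q..word_sum w n q + c / 2 ^ n}) \<subseteq> hit 1 n q"
        unfolding hit_def by fastforce
    qed (use hit_lmeasurable in \<open>auto intro!: sets.finite_UN\<close>)
    finally show ?thesis .
  qed
  \<comment> \<open>Decreasing in m and of finite measure, being inside \<open>{0..tail q}\<close>,
    so continuity from above applies.\<close>
  define F where "F m = (\<Union>n\<in>{m..}. hit 1 n q)" for m
  have Fl: "F m \<in> lmeasurable" for m
  proof (rule fmeasurableI2)
    show "F m \<in> sets lebesgue"
      unfolding F_def using hit_lmeasurable by (intro sets.countable_UN') auto
    show "F m \<subseteq> {0..tail q}" unfolding F_def using hit_subset[OF q] by blast
  qed simp
  have F: "ennreal (c / 2) \<le> emeasure lebesgue (F m)" for m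
  proof -
    obtain n where n: "m \<le> n" "real (card (close_pairs n (c / 2 ^ n) q)) < 2 ^ n / 2"
      using inf unfolding INFM_nat_le by blast
    have "ennreal (c / 2) \<le> emeasure lebesgue (hit 1 n q)"
      unfolding emeasure_eq_measure2[OF hit_lmeasurable] by (rule ennreal_leI[OF hit[OF n(2)]])
    also have "\<dots> \<le> emeasure lebesgue (F m)"
      using n(1) fmeasurableD[OF Fl] by (intro emeasure_mono) (auto simp: F_def)
    finally show ?thesis .
  qed
  have "decseq F" unfolding F_def decseq_def by fastforce
  then have "emeasure lebesgue (\<Inter>m. F m) = (INF m. emeasure lebesgue (F m))"
    using Fl fmeasurableD2[OF Fl] by (intro INF_emeasure_decseq[symmetric]) auto
  moreover have "ennreal (c / 2) \<le> (INF m. emeasure lebesgue (F m))"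
    using F by (intro INF_greatest)
  ultimately have "ennreal (c / 2) \<le> emeasure lebesgue (\<Inter>m. F m)" by (simp only:)
  also have "\<dots> \<le> emeasure lebesgue (hit_often q)"
  proof (rule emeasure_mono)
    show "(\<Inter>m. F m) \<subseteq> hit_often q" unfolding F_def hit_often_def INFM_nat_le by blast
    show "hit_often q \<in> sets lebesgue" using hit_often_lmeasurable[OF q] by (rule fmeasurableD)
  qed
  finally have "c / 2 \<le> measure lebesgue (hit_often q)"
    unfolding emeasure_eq_measure2[OF hit_often_lmeasurable[OF q]] by (subst (asm) ennreal_le_iff) auto
  then show ?thesis using c by linarith
qed

text \<open>Write x as \<open>word_sum w n q + q ^ n * y\<close> with y in
  \<open>{0..tail q}\<close>. The copy of \<open>hit_often q\<close> under the same affine map stays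
  in \<open>hit_often q\<close> and in the ball of radius q ^ n * tail q around x, filling the
  fraction \<mu> / (2 * tail q) of it. So the complement has density at most \<theta> < 1 at
  arbitrarily small scales.\<close>

lemma hit_often_full:
  assumes q: "1 / 2 < q" "q < 1" and sep: "separated_often q"
  shows "negligible ({0..tail q} - hit_often q)"
proof -
  let ?L = "hit_often q" and ?R = "tail q"
  define \<mu> where "\<mu> = measure lebesgue ?L"
  have \<mu>: "0 < \<mu>" unfolding \<mu>_def by (rule measure_hit_often_pos[OF assms])
  have L: "?L \<in> lmeasurable" by (rule hit_often_lmeasurable[OF q])
  have R: "1 \<le> ?R" by (rule tail_ge_1[OF q])
  have "\<mu> \<le> measure lebesgue {0..?R}"
    unfolding \<mu>_def using L hit_often_subset[OF q] by (intro measure_mono_fmeasurable) auto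
  then have \<mu>R: "\<mu> \<le> ?R" using R by simp
  define \<theta> where "\<theta> = 1 - \<mu> / (2 * ?R)"
  show ?thesis
  proof (rule negligible_if_density_less_1)
    show "{0..?R} - ?L \<in> lmeasurable" using L by (intro fmeasurable.Diff) auto
    show "0 \<le> \<theta>" "\<theta> < 1" using \<mu> \<mu>R R by (auto simp: \<theta>_def field_simps)
    fix x d :: real assume x: "x \<in> {0..?R} - ?L" and d: "0 < d"
    have "(\<lambda>n. q ^ n) \<longlonglongrightarrow> 0" using q by (intro LIMSEQ_power_zero) auto
    then have "(\<lambda>n. q ^ n * ?R) \<longlonglongrightarrow> 0 * ?R" by (intro tendsto_mult tendsto_const)
    then have "\<forall>\<^sub>F n in sequentially. q ^ n * ?R < d" using d by (intro order_tendstoD(2)) auto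
    then obtain n where n: "q ^ n * ?R < d" by (auto simp: eventually_sequentially)
    define r where "r = q ^ n * ?R"
    have r: "0 < r" "r < d" using n q R by (auto simp: r_def)
    obtain w y where w: "w \<in> words n" and y: "y \<in> {0..?R}" and xy: "x = word_sum w n q + q ^ n * y"
      using ex_word_remainder[OF q, of x n] x by blast
    let ?T = "\<lambda>z. q ^ n *\<^sub>R z + word_sum w n q"
    \<comment> \<open>As a preimage under a continuous map, the affine copy is a Borel set.\<close>
    have T_eq: "?T ` ?L = (\<lambda>x. (x - word_sum w n q) / q ^ n) -` ?L"
    proof (intro set_eqI iffI)
      fix x assume "x \<in> (\<lambda>x. (x - word_sum w n q) / q ^ n) -` ?L"
      then show "x \<in> ?T ` ?L" using q by (intro image_eqI) auto
    qed (use q in auto)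
    have "?T ` ?L \<in> sets borel"
      unfolding T_eq using hit_often_borel by (intro measurable_sets_borel[of _ borel]) auto
    then have Ts: "?T ` ?L \<in> sets lebesgue" by simp
    have Tm: "measure lebesgue (?T ` ?L) = q ^ n * \<mu>"
      using measure_lebesgue_affine[of "q ^ n" "word_sum w n q" ?L] q by (simp add: \<mu>_def)
    have TL: "?T ` ?L \<subseteq> ?L"
      using hit_often_invariant[OF q w] by (auto simp: add.commute)
    have Tl: "?T ` ?L \<in> lmeasurable" by (rule fmeasurableI2[OF L TL Ts])
    have Tb: "?T ` ?L \<subseteq> cball x r"
    proof (rule image_subsetI)
      fix z assume "z \<in> ?L"
      then have "z \<in> {0..?R}" using hit_often_subset[OF q] by blast
      then have "\<bar>y - z\<bar> \<le> ?R" using y by auto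
      then have "q ^ n * \<bar>y - z\<bar> \<le> r" unfolding r_def using q by (intro mult_left_mono) auto
      moreover have "x - ?T z = q ^ n * (y - z)" by (simp add: xy algebra_simps)
      then have "\<bar>x - ?T z\<bar> = q ^ n * \<bar>y - z\<bar>" using q by (simp add: abs_mult)
      ultimately show "?T z \<in> cball x r" by (simp only: mem_cball dist_real_def)
    qed
    have ball: "measure lebesgue (cball x r) = 2 * r"
      using r by (simp add: cball_eq_atLeastAtMost)
    have "measure lebesgue (({0..?R} - ?L) \<inter> cball x r) \<le> measure lebesgue (cball x r - ?T ` ?L)"
      using TL L by (intro measure_mono_fmeasurable fmeasurable.Diff Tl sets.Int sets.Diff) auto
    also have "\<dots> = measure lebesgue (cball x r) - measure lebesgue (?T ` ?L)"
      by (rule measurable_measure_Diff[OF _ fmeasurableD[OF Tl] Tb]) simp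
    also have "\<dots> = 2 * r - q ^ n * \<mu>" unfolding ball Tm ..
    also have "\<dots> = \<theta> * (2 * r)" using R by (simp add: \<theta>_def r_def field_simps)
    finally have "measure lebesgue (({0..?R} - ?L) \<inter> cball x r) \<le> \<theta> * measure lebesgue (cball x r)"
      unfolding ball .
    then show "\<exists>r. 0 < r \<and> r < d \<and>
        measure lebesgue (({0..?R} - ?L) \<inter> cball x r) \<le> \<theta> * measure lebesgue (cball x r)"
      using r by blast
  qed
qed

section \<open>Construction of expansions\<close>

definition expansion_approximable :: "real \<Rightarrow> (nat \<Rightarrow> real) \<Rightarrow> real set" where
  "expansion_approximable q \<omega> = {x. \<exists>\<epsilon>. (\<forall>i\<ge>1. \<epsilon> i \<in> {0, 1}) \<and>
     (\<lambda>i. real (\<epsilon> (Suc i)) * q ^ Suc i) sums x \<and>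
     (\<exists>\<^sub>\<infinity>n. 0 \<le> x - word_sum \<epsilon> n q \<and> x - word_sum \<epsilon> n q \<le> \<omega> n / 2 ^ n)}"

text \<open>Excluding all words at once keeps the rescaled remainders of a construction in
  \<open>hit_often q\<close>, whichever words it picks.\<close>

definition exceptional_points :: "real \<Rightarrow> real set" where
  "exceptional_points q =
     (\<Union>n. \<Union>w\<in>words n. (\<lambda>y. word_sum w n q + q ^ n * y) ` ({0..tail q} - hit_often q))"

lemma negligible_exceptional_points:
  assumes "1 / 2 < q" "q < 1" "separated_often q"
  shows "negligible (exceptional_points q)"
proof -
  have "negligible ((\<lambda>y. word_sum w n q + q ^ n * y) ` ({0..tail q} - hit_often q))" for w n
    by (intro negligible_differentiable_image_negligible hit_often_full assms derivative_intros) auto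
  then show ?thesis
    unfolding exceptional_points_def by (intro negligible_Union_nat negligible_Union) auto
qed

text \<open>As \<open>x\<close> is not exceptional, its rescaled remainder lies in
  \<open>hit_often q\<close>; a word that hits this remainder at a late enough level is appended to
  \<open>w\<close>.\<close>

lemma extend_word:
  assumes q: "1 / 2 < q" "q < 1" and \<omega>: "filterlim \<omega> at_top sequentially"
    and x: "x \<notin> exceptional_points q"
    and w: "w \<in> words n" "0 \<le> x - word_sum w n q" "x - word_sum w n q \<le> q ^ n * tail q"
  obtains n' w' where "n < n'" "w' \<in> words n'" "\<And>i. i \<in> {1..n} \<Longrightarrow> w' i = w i"
    "0 \<le> x - word_sum w' n' q" "x - word_sum w' n' q \<le> q ^ n' * tail q"
    "x - word_sum w' n' q \<le> \<omega> n' / 2 ^ n'"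
proof -
  define y where "y = (x - word_sum w n q) / q ^ n"
  have xy: "x = word_sum w n q + q ^ n * y" using q by (simp add: y_def)
  have "0 \<le> y" using q w by (simp add: y_def)
  moreover have "y \<le> tail q" using q w by (simp add: y_def divide_le_eq mult.commute)
  ultimately have "y \<in> hit_often q"
    using x w(1) xy unfolding exceptional_points_def by fastforce
  then obtain C where C: "\<exists>\<^sub>\<infinity>m. y \<in> hit C m q" by (auto simp: hit_often_def)
  \<comment> \<open>The current length \<open>n\<close> is fixed, so passing from 1 / 2 ^ m to 1 / 2
    ^ (n + m) costs only the constant 2 ^ n, which \<omega> eventually exceeds together with
    \<open>C\<close>.\<close>
  obtain N where N: "\<And>m. N \<le> m \<Longrightarrow> real C * 2 ^ n \<le> \<omega> m"
    using \<omega> unfolding filterlim_at_top eventually_sequentially by blast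
  obtain m where m: "max 1 N \<le> m" "y \<in> hit C m q"
    using C unfolding INFM_nat_le by blast
  obtain v where v: "v \<in> words m" "0 \<le> y - word_sum v m q"
      "y - word_sum v m q \<le> real C / 2 ^ m" "y - word_sum v m q \<le> q ^ m * tail q"
    by (rule hitE[OF m(2)])
  let ?u = "append_word n m w v"
  have diff: "x - word_sum ?u (n + m) q = q ^ n * (y - word_sum v m q)"
    unfolding word_sum_append by (simp add: xy algebra_simps)
  show thesis
  proof (rule that[of "n + m" ?u])
    show "n < n + m" using m(1) by simp
    show "?u \<in> words (n + m)" by (rule append_word_in_words[OF w(1) v(1)])
    show "?u i = w i" if "i \<in> {1..n}" for i using that by (simp add: append_word_def)
    show "0 \<le> x - word_sum ?u (n + m) q" unfolding diff using v(2) q by simp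
    have "q ^ n * (y - word_sum v m q) \<le> q ^ n * (q ^ m * tail q)"
      using q v by (intro mult_left_mono) auto
    then show "x - word_sum ?u (n + m) q \<le> q ^ (n + m) * tail q"
      unfolding diff by (simp add: power_add mult.assoc)
    have "q ^ n * (y - word_sum v m q) \<le> 1 * (real C / 2 ^ m)"
      using q v by (intro mult_mono power_le_one) auto
    also have "\<dots> = real C * 2 ^ n / 2 ^ (n + m)" by (simp add: power_add)
    also have "\<dots> \<le> \<omega> (n + m) / 2 ^ (n + m)"
      using N[of "n + m"] m(1) by (intro divide_right_mono) auto
    finally show "x - word_sum ?u (n + m) q \<le> \<omega> (n + m) / 2 ^ (n + m)" unfolding diff .
  qed
qed

text \<open>Iterating \<open>extend_word\<close> from the empty word gives words that extend each
  other. Their common digits form an expansion of \<open>x\<close>, since the remainders are at most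
  q ^ N * tail q and tend to 0.\<close>

lemma expansion_approximable_if_not_exceptional:
  assumes q: "1 / 2 < q" "q < 1" and \<omega>: "filterlim \<omega> at_top sequentially"
    and x: "x \<in> {0..tail q}" "x \<notin> exceptional_points q"
  shows "x \<in> expansion_approximable q \<omega>"
proof -
  \<comment> \<open>The bound by \<omega> is demanded only from stage 1 on, since the empty word of
    stage 0 need not satisfy it.\<close>
  define P :: "nat \<Rightarrow> nat \<times> (nat \<Rightarrow> nat) \<Rightarrow> bool" where
    "P j s \<longleftrightarrow> (case s of (n, w) \<Rightarrow> w \<in> words n \<and> 0 \<le> x - word_sum w n q \<and>
       x - word_sum w n q \<le> q ^ n * tail q \<and> (0 < j \<longrightarrow> x - word_sum w n q \<le> \<omega> n / 2 ^ n))" for j s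
  define Q :: "nat \<Rightarrow> nat \<times> (nat \<Rightarrow> nat) \<Rightarrow> nat \<times> (nat \<Rightarrow> nat) \<Rightarrow> bool" where
    "Q j s s' \<longleftrightarrow> fst s < fst s' \<and> (\<forall>i\<in>{1..fst s}. snd s' i = snd s i)" for j s s'
  have "\<exists>f. \<forall>j. P j (f j) \<and> Q j (f j) (f (Suc j))"
  proof (rule dependent_nat_choice)
    have "P 0 (0, \<lambda>i. undefined)" using x by (simp add: P_def words_def word_sum_def)
    then show "\<exists>s. P 0 s" by blast
    fix s j assume "P j s"
    then obtain n w where s: "s = (n, w)" "w \<in> words n" "0 \<le> x - word_sum w n q"
        "x - word_sum w n q \<le> q ^ n * tail q"
      by (cases s) (simp add: P_def)
    obtain n' w' where "n < n'" "w' \<in> words n'" "\<And>i. i \<in> {1..n} \<Longrightarrow> w' i = w i"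
      "0 \<le> x - word_sum w' n' q" "x - word_sum w' n' q \<le> q ^ n' * tail q"
      "x - word_sum w' n' q \<le> \<omega> n' / 2 ^ n'"
      using extend_word[OF q \<omega> x(2) s(2-4)] by blast
    then have "P (Suc j) (n', w') \<and> Q j s (n', w')" by (simp add: P_def Q_def s(1))
    then show "\<exists>s'. P (Suc j) s' \<and> Q j s s'" by blast
  qed
  then obtain f where f: "\<And>j. P j (f j)" "\<And>j. Q j (f j) (f (Suc j))" by blast
  define N where "N j = fst (f j)" for j
  define W where "W j = snd (f j)" for j
  have W: "W j \<in> words (N j)" "0 \<le> x - word_sum (W j) (N j) q"
    "x - word_sum (W j) (N j) q \<le> q ^ N j * tail q" for j
    using f(1)[of j] by (simp_all add: P_def N_def W_def case_prod_beta)
  have W\<omega>: "x - word_sum (W j) (N j) q \<le> \<omega> (N j) / 2 ^ N j" if "0 < j" for j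
    using f(1)[of j] that by (simp add: P_def N_def W_def case_prod_beta)
  have N: "strict_mono N" unfolding strict_mono_Suc_iff using f(2) by (simp add: Q_def N_def)
  have WSuc: "W (Suc j) i = W j i" if "i \<in> {1..N j}" for i j
    using f(2)[of j] that by (simp add: Q_def N_def W_def)
  have W_stable: "W k i = W j i" if "j \<le> k" "i \<in> {1..N j}" for i j k
    using that(1)
  proof (induction k rule: dec_induct)
    case (step k)
    have "N j \<le> N k" using N step.hyps(1) by (simp add: strict_mono_less_eq)
    then show ?case using WSuc[of i k] step.IH that(2) by simp
  qed simp
  \<comment> \<open>Diagonal choice: i <= N i, so the word of stage i has a digit at position i, and
    later words keep it.\<close>
  define \<epsilon> where "\<epsilon> i = W i i" for i
  have N_ge: "i \<le> N i" for i by (rule strict_mono_imp_increasing[OF N])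
  have \<epsilon>W: "W j i = \<epsilon> i" if "i \<in> {1..N j}" for i j
  proof (cases "i \<le> j")
    case True
    then show ?thesis using W_stable[of i j i] N_ge[of i] that by (simp add: \<epsilon>_def)
  next
    case False
    then show ?thesis using W_stable[of j i i] that by (simp add: \<epsilon>_def)
  qed
  have \<epsilon>01: "\<epsilon> i = 0 \<or> \<epsilon> i = 1" if "1 \<le> i" for i
    using words_le_1[OF W(1)[of i], of i] N_ge[of i] that by (simp add: \<epsilon>_def)
  have sum_\<epsilon>: "word_sum \<epsilon> (N j) q = word_sum (W j) (N j) q" for j
    using \<epsilon>W by (intro word_sum_cong) simp
  let ?t = "\<lambda>i. real (\<epsilon> (Suc i)) * q ^ Suc i"
  have "summable ?t"
  proof (rule summable_comparison_test')
    show "summable (\<lambda>i. q ^ Suc i)" using q by (simp add: summable_geometric summable_mult)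
    show "norm (?t i) \<le> q ^ Suc i" for i using \<epsilon>01[of "Suc i"] q by auto
  qed
  then have "(\<lambda>n. \<Sum>i<n. ?t i) \<longlonglongrightarrow> suminf ?t" by (rule summable_LIMSEQ)
  moreover have "(\<Sum>i<n. ?t i) = word_sum \<epsilon> n q" for n
    unfolding word_sum_def by (simp add: sum.atLeast1_atMost_eq)
  ultimately have "(\<lambda>n. word_sum \<epsilon> n q) \<longlonglongrightarrow> suminf ?t" by simp
  then have lim1: "(\<lambda>j. word_sum \<epsilon> (N j) q) \<longlonglongrightarrow> suminf ?t"
    using LIMSEQ_subseq_LIMSEQ[OF _ N] by (simp add: o_def)
  have "(\<lambda>j. x - word_sum \<epsilon> (N j) q) \<longlonglongrightarrow> 0"
  proof (rule tendsto_sandwich[where f = "\<lambda>_. 0" and h = "\<lambda>j. q ^ N j * tail q"])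
    have "(\<lambda>n. q ^ n * tail q) \<longlonglongrightarrow> 0 * tail q"
      using q by (intro tendsto_mult LIMSEQ_power_zero tendsto_const) auto
    then show "(\<lambda>j. q ^ N j * tail q) \<longlonglongrightarrow> 0"
      using LIMSEQ_subseq_LIMSEQ[OF _ N] by (force simp: o_def)
    show "\<forall>\<^sub>F j in sequentially. 0 \<le> x - word_sum \<epsilon> (N j) q"
      unfolding sum_\<epsilon> using W(2) by (intro always_eventually allI)
    show "\<forall>\<^sub>F j in sequentially. x - word_sum \<epsilon> (N j) q \<le> q ^ N j * tail q"
      unfolding sum_\<epsilon> using W(3) by (intro always_eventually allI)
  qed simp
  then have "(\<lambda>j. x - (x - word_sum \<epsilon> (N j) q)) \<longlonglongrightarrow> x - 0"
    by (intro tendsto_diff tendsto_const)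
  then have "(\<lambda>j. word_sum \<epsilon> (N j) q) \<longlonglongrightarrow> x" by simp
  then have "suminf ?t = x" using lim1 LIMSEQ_unique by blast
  then have "?t sums x" using \<open>summable ?t\<close> by (simp add: sums_iff)
  moreover have "\<exists>\<^sub>\<infinity>n. 0 \<le> x - word_sum \<epsilon> n q \<and> x - word_sum \<epsilon> n q \<le> \<omega> n / 2 ^ n"
    unfolding INFM_nat_le
  proof
    fix m
    show "\<exists>n\<ge>m. 0 \<le> x - word_sum \<epsilon> n q \<and> x - word_sum \<epsilon> n q \<le> \<omega> n / 2 ^ n"
      using W(2)[of "Suc m"] W\<omega>[of "Suc m"] N_ge[of "Suc m"] sum_\<epsilon>[of "Suc m"]
      by (intro exI[of _ "N (Suc m)"]) auto
  qed
  ultimately show ?thesis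
    unfolding expansion_approximable_def using \<epsilon>01 by auto
qed

section \<open>Return from the ratio q to \<beta>\<close>

lemma expansion_approximable_inverse:
  assumes "1 < \<beta>" "x \<in> I_beta \<beta>" "x \<in> expansion_approximable (1 / \<beta>) \<omega>"
  shows "x \<in> well_approximable \<beta> \<omega>"
  using assms unfolding well_approximable_def expansion_approximable_def beta_expansion_def word_sum_def
  by (simp add: divide_inverse power_inverse)

lemma tail_inverse: "1 < \<beta> \<Longrightarrow> tail (1 / \<beta>) = 1 / (\<beta> - 1)"
  by (simp add: tail_def field_simps)

text \<open>The estimates require a left endpoint a > 1/2, so the ratios are exhausted by intervals
  starting at 1/2 + 1 / (j + 1). Inversion is differentiable away from 0 and maps null sets to null
  sets.\<close>

lemma negligible_not_separated_often_inverse: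
  "negligible {\<beta> \<in> {beta_transversality<..<2}. \<not> separated_often (1 / \<beta>)}"
proof -
  let ?A = "\<lambda>j. {q \<in> {1 / 2 + 1 / real (Suc j)..0.668}. \<not> separated_often q}"
  have "negligible (\<Union>j. ?A j)"
    by (intro negligible_Union_nat negligible_not_separated_often) simp
  moreover have "(\<lambda>q. 1 / q) differentiable_on (\<Union>j. ?A j)"
    unfolding differentiable_on_def
  proof
    fix q assume "q \<in> (\<Union>j. ?A j)"
    then obtain j where "1 / 2 + 1 / real (Suc j) \<le> q" by (auto simp del: of_nat_Suc)
    moreover have "0 < 1 / 2 + 1 / real (Suc j)" by (simp add: add_pos_pos)
    ultimately have "q \<noteq> 0" by linarith
    then show "(\<lambda>q. 1 / q) differentiable at q within (\<Union>j. ?A j)"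
      by (intro derivative_intros) auto
  qed
  ultimately have "negligible ((\<lambda>q. 1 / q) ` (\<Union>j. ?A j))"
    by (intro negligible_differentiable_image_negligible) auto
  then show ?thesis
  proof (rule negligible_subset, intro subsetI)
    fix \<beta> assume "\<beta> \<in> {\<beta> \<in> {beta_transversality<..<2}. \<not> separated_often (1 / \<beta>)}"
    then have \<beta>: "beta_transversality < \<beta>" "\<beta> < 2" "\<not> separated_often (1 / \<beta>)" by auto
    have "0 < \<beta>" using \<beta>(1) by (simp add: beta_transversality_def)
    have "1 / 2 < 1 / \<beta>" using \<beta>(2) \<open>0 < \<beta>\<close> by (simp add: field_simps)
    then obtain j where "1 / real (Suc j) < 1 / \<beta> - 1 / 2"
      using nat_approx_posE[of "1 / \<beta> - 1 / 2"] by auto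
    moreover have "1 / \<beta> \<le> 0.668" using \<beta>(1) \<open>0 < \<beta>\<close> by (simp add: beta_transversality_def field_simps)
    ultimately have "1 / \<beta> \<in> ?A j" using \<beta>(3) by auto
    then show "\<beta> \<in> (\<lambda>q. 1 / q) ` (\<Union>j. ?A j)"
      by (intro image_eqI[of _ _ "1 / \<beta>"]) auto
  qed
qed

theorem theorem1p5:
  fixes \<omega> :: "nat \<Rightarrow> real"
  assumes "filterlim \<omega> at_top sequentially"
    and "growing_regularly \<omega>"
  shows "AE \<beta>\<in>{beta_transversality<..<2} in lebesgue.
           AE x\<in>I_beta \<beta> in lebesgue. x \<in> well_approximable \<beta> \<omega>"
proof (rule AE_I')
  show "{\<beta> \<in> {beta_transversality<..<2}. \<not> separated_often (1 / \<beta>)} \<in> null_sets lebesgue"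
    using negligible_not_separated_often_inverse by (simp only: negligible_iff_null_sets)
  have "AE x\<in>I_beta \<beta> in lebesgue. x \<in> well_approximable \<beta> \<omega>"
    if \<beta>: "beta_transversality < \<beta>" "\<beta> < 2" and sep: "separated_often (1 / \<beta>)" for \<beta>
  proof (rule AE_I')
    have \<beta>1: "1 < \<beta>" using \<beta>(1) by (simp add: beta_transversality_def)
    have q: "1 / 2 < 1 / \<beta>" "1 / \<beta> < 1" using \<beta>1 \<beta>(2) by (simp_all add: field_simps)
    show "exceptional_points (1 / \<beta>) \<in> null_sets lebesgue"
      using negligible_exceptional_points[OF q sep] by (simp only: negligible_iff_null_sets)
    \<comment> \<open>For this \<beta>, every point of \<open>I_beta \<beta>\<close> outside the
      null set of exceptional points for q = 1 / \<beta> has the required expansion.\<close>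
    show "{x \<in> space lebesgue. \<not> (x \<in> I_beta \<beta> \<longrightarrow> x \<in> well_approximable \<beta> \<omega>)}
        \<subseteq> exceptional_points (1 / \<beta>)"
      using expansion_approximable_inverse[OF \<beta>1]
        expansion_approximable_if_not_exceptional[OF q assms(1)]
      unfolding I_beta_def tail_inverse[OF \<beta>1] by blast
  qed
  then show "{\<beta> \<in> space lebesgue. \<not> (\<beta> \<in> {beta_transversality<..<2} \<longrightarrow>
      (AE x\<in>I_beta \<beta> in lebesgue. x \<in> well_approximable \<beta> \<omega>))}
      \<subseteq> {\<beta> \<in> {beta_transversality<..<2}. \<not> separated_often (1 / \<beta>)}"
    by auto
qed

end
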